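(* Let $(\Sigma_{K_i,m_i}: i\in I)$ be a family of completions of $\Sigma_{\operatorname{normal}}$ and let $\mathcal U$ be an ultrafilter on $I$ such that $\lim_{\mathcal U}\Sigma_{K_i,m_i}=\Sigma_{K,m}$. Then: (1) $K=\lim_{\mathcal U}K_i$ in the Hausdorff metric; and (2) for each $\lambda\in\operatorname{Isol}(K)$, $m(\lambda)=\inf_{k}\lim_{\mathcal U} m_i(B(\lambda;1/k))$.
   Context: $L$ is the continuous-logic language of unit balls of complex Hilbert spaces expanded by a unary function symbol $T$. $\Sigma_{\operatorname{normal}}$ is the $L$-theory whose models are $(H,T)$ with $H$ an infinite-dimensional complex Hilbert space and $T$ a normal operator on $H$ with $\|T\|\le 1$. For a compact $K\subseteq\mathbb D=\{z\in\mathbb C:|z|\le 1\}$ and $m:\operatorname{Isol}(K)\to\mathbb N\cup\{\infty\}$, $\Sigma_{K,m}$ is the theory whose models are the models $(H,T)$ of $\Sigma_{\operatorname{normal}}$ with $\sigma(T)=K$ and $\dim\ker(T-\lambda)=m(\lambda)$ for each isolated point $\lambda$ of $K$ ($\infty$ meaning infinite-dimensional); these are exactly the completions of $\Sigma_{\operatorname{normal}}$. $\lim_{\mathcal U}\Sigma_i=\Sigma$ refers to the logic topology on complete theories: equivalently, $\Sigma$ is the theory of the ultraproduct $\prod_{\mathcal U}(H_i,T_i)$ for any models $(H_i,T_i)\models\Sigma_i$. For a Borel set $B\subseteq\mathbb C$, $m_i(B)\in\mathbb N\cup\{\infty\}$ denotes the rank of the spectral projection $E_i(B)$ in a model $(H_i,T_i)$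 of $\Sigma_{K_i,m_i}$ (i.e. $\dim E_i(B)(H_i)$, which is $\sum_{\mu\in B\cap K_i} m_i(\mu)$ if $B\cap K_i$ consists of isolated points of $K_i$ and is infinite otherwise); $B(\lambda;r)$ is the open disc of radius $r$ about $\lambda$. *)

theory Defs
  imports "HOL-Analysis.Analysis"
begin

section \<open>Complex Hilbert spaces\<close>

text \<open>The inner product is linear in the first argument. The norm is the one inherited from
  \<^class>\<open>real_inner\<close>, since the real part of \<open>cinner\<close> is \<^const>\<open>inner\<close>.\<close>

class complex_inner_space = real_inner +
  fixes scaleC :: "complex \<Rightarrow> 'a \<Rightarrow> 'a"  (infixr \<open>*\<^sub>C\<close> 75)
    and cinner :: "'a \<Rightarrow> 'a \<Rightarrow> complex"
  assumes scaleC_add_right: "c *\<^sub>C (x + y) = c *\<^sub>C x + c *\<^sub>C y"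
    and scaleC_add_left: "(c + d) *\<^sub>C x = c *\<^sub>C x + d *\<^sub>C x"
    and scaleC_scaleC: "c *\<^sub>C (d *\<^sub>C x) = (c * d) *\<^sub>C x"
    and scaleR_scaleC: "r *\<^sub>R x = complex_of_real r *\<^sub>C x"
    and cinner_commute: "cinner x y = cnj (cinner y x)"
    and cinner_add_left: "cinner (x + y) z = cinner x z + cinner y z"
    and cinner_scaleC_left: "cinner (c *\<^sub>C x) y = c * cinner x y"
    and inner_eq_Re_cinner: "inner x y = Re (cinner x y)"

class complex_hilbert_space = complex_inner_space + complete_space

lemma scaleC_one: "1 *\<^sub>C x = (x::'a::complex_inner_space)"
  using scaleR_scaleC[of 1 x] by simp

global_interpretation complex_vector:
  vector_space "scaleC :: complex \<Rightarrow> 'a \<Rightarrow> 'a::complex_inner_space"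
  defines csubspace = complex_vector.subspace
    and cspan = complex_vector.span
    and cdim_nat = complex_vector.dim
  by unfold_locales
    (simp_all add: scaleC_add_right scaleC_add_left scaleC_scaleC scaleC_one)

text \<open>The library dimension is \<open>0\<close> on infinite-dimensional spaces; here it is \<open>\<infinity>\<close>.\<close>

definition cdim :: "'a::complex_inner_space set \<Rightarrow> enat" where
  "cdim V = (if \<exists>B. finite B \<and> V \<subseteq> cspan B then enat (cdim_nat V) else \<infinity>)"

text \<open>A Hilbert space is rendered as a closed complex subspace \<open>H\<close> of an ambient Hilbert space, so
  that a family of models can consist of Hilbert spaces of different dimensions. Nothing is lost:
  any family of Hilbert spaces embeds isometrically as closed subspaces of their direct sum.
  An operator on \<open>H\<close> is a function whose values outside \<open>H\<close> are irrelevant.\<close>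

definition hilbert_subspace :: "'a::complex_hilbert_space set \<Rightarrow> bool" where
  "hilbert_subspace H \<longleftrightarrow> csubspace H \<and> closed H"

definition linear_op_on :: "'a::complex_hilbert_space set \<Rightarrow> ('a \<Rightarrow> 'a) \<Rightarrow> bool" where
  "linear_op_on H T \<longleftrightarrow> (\<forall>x\<in>H. T x \<in> H) \<and> (\<forall>x\<in>H. \<forall>y\<in>H. T (x + y) = T x + T y)
     \<and> (\<forall>c. \<forall>x\<in>H. T (c *\<^sub>C x) = c *\<^sub>C T x)"

definition bounded_op_on :: "'a::complex_hilbert_space set \<Rightarrow> ('a \<Rightarrow> 'a) \<Rightarrow> bool" where
  "bounded_op_on H T \<longleftrightarrow> linear_op_on H T \<and> (\<exists>C. \<forall>x\<in>H. norm (T x) \<le> C * norm x)"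

definition contraction_on :: "'a::complex_hilbert_space set \<Rightarrow> ('a \<Rightarrow> 'a) \<Rightarrow> bool" where
  "contraction_on H T \<longleftrightarrow> linear_op_on H T \<and> (\<forall>x\<in>H. norm (T x) \<le> norm x)"

definition is_adjoint_on ::
  "'a::complex_hilbert_space set \<Rightarrow> ('a \<Rightarrow> 'a) \<Rightarrow> ('a \<Rightarrow> 'a) \<Rightarrow> bool" where
  "is_adjoint_on H T S \<longleftrightarrow> bounded_op_on H S \<and> (\<forall>x\<in>H. \<forall>y\<in>H. cinner (T x) y = cinner x (S y))"

definition normal_on :: "'a::complex_hilbert_space set \<Rightarrow> ('a \<Rightarrow> 'a) \<Rightarrow> bool" where
  "normal_on H T \<longleftrightarrow> bounded_op_on H T \<and>
     (\<exists>S. is_adjoint_on H T S \<and> (\<forall>x\<in>H. S (T x) = T (S x)))"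

definition spectrum_on :: "'a::complex_hilbert_space set \<Rightarrow> ('a \<Rightarrow> 'a) \<Rightarrow> complex set" where
  "spectrum_on H T = {\<mu>. \<not> (\<exists>R. bounded_op_on H R \<and>
     (\<forall>x\<in>H. R (T x - \<mu> *\<^sub>C x) = x \<and> T (R x) - \<mu> *\<^sub>C R x = x))}"

definition eigenspace_on ::
  "'a::complex_hilbert_space set \<Rightarrow> ('a \<Rightarrow> 'a) \<Rightarrow> complex \<Rightarrow> 'a set" where
  "eigenspace_on H T \<mu> = {x\<in>H. T x = \<mu> *\<^sub>C x}"

definition orthogonal_projection_on ::
  "'a::complex_hilbert_space set \<Rightarrow> ('a \<Rightarrow> 'a) \<Rightarrow> bool" where
  "orthogonal_projection_on H P \<longleftrightarrow>
     bounded_op_on H P \<and> (\<forall>x\<in>H. P (P x) = P x) \<and> is_adjoint_on H P P"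


subsection \<open>The spectral measure of a normal operator\<close>

text \<open>The positive measure \<open>B \<mapsto> \<langle>E(B)x, x\<rangle>\<close> on the Borel sets of the plane.\<close>

definition scalar_spectral_measure ::
  "(complex set \<Rightarrow> 'a \<Rightarrow> 'a) \<Rightarrow> 'a::complex_hilbert_space \<Rightarrow> complex measure" where
  "scalar_spectral_measure E x =
     measure_of UNIV (sets borel) (\<lambda>B. ennreal (Re (cinner (E B x) x)))"

text \<open>\<open>E\<close> is the resolution of the identity of \<open>T\<close>: a projection-valued Borel measure, countably
  additive in the strong operator topology and concentrated on the spectrum, such that \<open>T\<close> is the
  integral of the identity function with respect to \<open>E\<close>. The last condition is expressed through
  the quadratic forms \<open>\<langle>Tx, x\<rangle>\<close>, which determine \<open>T\<close> by polarization. By the spectral theorem every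
  bounded normal operator has exactly one such \<open>E\<close>.\<close>

definition is_spectral_measure_on ::
  "'a::complex_hilbert_space set \<Rightarrow> ('a \<Rightarrow> 'a) \<Rightarrow> (complex set \<Rightarrow> 'a \<Rightarrow> 'a) \<Rightarrow> bool" where
  "is_spectral_measure_on H T E \<longleftrightarrow>
     (\<forall>B\<in>sets borel. orthogonal_projection_on H (E B)) \<and>
     (\<forall>x\<in>H. E (spectrum_on H T) x = x) \<and>
     (\<forall>x\<in>H. E UNIV x = x) \<and>
     (\<forall>A\<in>sets borel. \<forall>B\<in>sets borel. \<forall>x\<in>H. E (A \<inter> B) x = E A (E B x)) \<and>
     (\<forall>A :: nat \<Rightarrow> complex set. range A \<subseteq> sets borel \<longrightarrow> disjoint_family A \<longrightarrow>
        (\<forall>x\<in>H. (\<lambda>n. E (A n) x) sums E (\<Union>n. A n) x)) \<and>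
     (\<forall>x\<in>H. cinner (T x) x = integral\<^sup>L (scalar_spectral_measure E x) (\<lambda>z. z))"


section \<open>The continuous-logic language of unit balls with a unary function symbol\<close>

text \<open>\<open>Comb \<alpha> \<beta> s t\<close> stands for \<open>\<alpha>s + \<beta>t\<close>; it is a symbol of the language when \<open>|\<alpha>| + |\<beta>| \<le> 1\<close>, so
  that it maps the unit ball to itself. The zero vector is \<open>Comb 0 0 s t\<close>.\<close>

datatype tm = Var nat | Comb complex complex tm tm | Op tm

text \<open>\<open>Conn c [\<phi>\<^sub>0, \<dots>, \<phi>\<^sub>n]\<close> applies a connective to finitely many formulas. An \<open>n\<close>-ary connective is a
  continuous function of \<open>n\<close> real variables; it is coded as a continuous function on real sequences
  (product topology), which is evaluated on the argument values padded with zeros. Every continuous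
  function of \<open>n\<close> real variables arises in this way, and only those do.\<close>

datatype fm =
    Dist tm tm
  | ReInner tm tm
  | ImInner tm tm
  | Conn "(nat \<Rightarrow> real) \<Rightarrow> real" "fm list"
  | SupQ nat fm
  | InfQ nat fm

primrec wf_tm :: "tm \<Rightarrow> bool" where
  "wf_tm (Var n) = True"
| "wf_tm (Comb \<alpha> \<beta> s t) = (cmod \<alpha> + cmod \<beta> \<le> 1 \<and> wf_tm s \<and> wf_tm t)"
| "wf_tm (Op t) = wf_tm t"

primrec fv_tm :: "tm \<Rightarrow> nat set" where
  "fv_tm (Var n) = {n}"
| "fv_tm (Comb \<alpha> \<beta> s t) = fv_tm s \<union> fv_tm t"
| "fv_tm (Op t) = fv_tm t"

primrec wf_fm :: "fm \<Rightarrow> bool" where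
  "wf_fm (Dist s t) = (wf_tm s \<and> wf_tm t)"
| "wf_fm (ReInner s t) = (wf_tm s \<and> wf_tm t)"
| "wf_fm (ImInner s t) = (wf_tm s \<and> wf_tm t)"
| "wf_fm (Conn c \<phi>s) = (continuous_on UNIV c \<and> list_all id (map wf_fm \<phi>s))"
| "wf_fm (SupQ n \<phi>) = wf_fm \<phi>"
| "wf_fm (InfQ n \<phi>) = wf_fm \<phi>"

primrec fv_fm :: "fm \<Rightarrow> nat set" where
  "fv_fm (Dist s t) = fv_tm s \<union> fv_tm t"
| "fv_fm (ReInner s t) = fv_tm s \<union> fv_tm t"
| "fv_fm (ImInner s t) = fv_tm s \<union> fv_tm t"
| "fv_fm (Conn c \<phi>s) = \<Union> (set (map fv_fm \<phi>s))"
| "fv_fm (SupQ n \<phi>) = fv_fm \<phi> - {n}"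
| "fv_fm (InfQ n \<phi>) = fv_fm \<phi> - {n}"

definition sentences :: "fm set" where
  "sentences = {\<phi>. wf_fm \<phi> \<and> fv_fm \<phi> = {}}"

primrec tm_val :: "('a \<Rightarrow> 'a) \<Rightarrow> tm \<Rightarrow> (nat \<Rightarrow> 'a::complex_hilbert_space) \<Rightarrow> 'a" where
  "tm_val T (Var n) v = v n"
| "tm_val T (Comb \<alpha> \<beta> s t) v = \<alpha> *\<^sub>C tm_val T s v + \<beta> *\<^sub>C tm_val T t v"
| "tm_val T (Op t) v = T (tm_val T t v)"

primrec fm_val ::
  "'a::complex_hilbert_space set \<Rightarrow> ('a \<Rightarrow> 'a) \<Rightarrow> fm \<Rightarrow> (nat \<Rightarrow> 'a) \<Rightarrow> real" where
  "fm_val H T (Dist s t) = (\<lambda>v. dist (tm_val T s v) (tm_val T t v))"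
| "fm_val H T (ReInner s t) = (\<lambda>v. Re (cinner (tm_val T s v) (tm_val T t v)))"
| "fm_val H T (ImInner s t) = (\<lambda>v. Im (cinner (tm_val T s v) (tm_val T t v)))"
| "fm_val H T (Conn c \<phi>s) =
     (\<lambda>v. c (\<lambda>j. if j < length \<phi>s then (map (fm_val H T) \<phi>s ! j) v else 0))"
| "fm_val H T (SupQ n \<phi>) = (\<lambda>v. SUP x\<in>H \<inter> cball 0 1. fm_val H T \<phi> (v(n := x)))"
| "fm_val H T (InfQ n \<phi>) = (\<lambda>v. INF x\<in>H \<inter> cball 0 1. fm_val H T \<phi> (v(n := x)))"

text \<open>A complete theory is identified with the assignment of a real value to each sentence. The logic
  topology is the weakest topology on complete theories that makes all the evaluations
  \<open>\<Sigma> \<mapsto> \<phi>\<^sup>\<Sigma>\<close> continuous, i.e. the topology induced by the product topology.\<close>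

definition complete_theory ::
  "'a::complex_hilbert_space set \<Rightarrow> ('a \<Rightarrow> 'a) \<Rightarrow> fm \<Rightarrow> real" where
  "complete_theory H T = (\<lambda>\<phi>\<in>sentences. fm_val H T \<phi> (\<lambda>_. 0))"

definition logic_topology :: "(fm \<Rightarrow> real) topology" where
  "logic_topology = product_topology (\<lambda>_. euclideanreal) sentences"


section \<open>The theory of normal operators and its completions\<close>

definition models_normal :: "'a::complex_hilbert_space set \<Rightarrow> ('a \<Rightarrow> 'a) \<Rightarrow> bool" where
  "models_normal H T \<longleftrightarrow>
     hilbert_subspace H \<and> cdim H = \<infinity> \<and> contraction_on H T \<and> normal_on H T"

text \<open>\<open>models_completion K m H T\<close> says that \<open>(H,T)\<close> is a model of \<open>\<Sigma>\<^bsub>K,m\<^esub>\<close>. As \<open>\<Sigma>\<^bsub>K,m\<^esub>\<close> is complete,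
  it is then equal to \<open>complete_theory H T\<close>. Only the values of \<open>m\<close> at isolated points of \<open>K\<close>
  matter.\<close>

definition models_completion ::
  "complex set \<Rightarrow> (complex \<Rightarrow> enat) \<Rightarrow> 'a::complex_hilbert_space set \<Rightarrow> ('a \<Rightarrow> 'a) \<Rightarrow> bool" where
  "models_completion K m H T \<longleftrightarrow>
     models_normal H T \<and> spectrum_on H T = K \<and>
     (\<forall>\<mu>. \<mu> isolated_in K \<longrightarrow> cdim (eigenspace_on H T \<mu>) = m \<mu>)"


section \<open>Ultrafilters and the Hausdorff distance\<close>

definition ultrafilter :: "'i filter \<Rightarrow> bool" where
  "ultrafilter \<U> \<longleftrightarrow> \<U> \<noteq> bot \<and> (\<forall>P. eventually P \<U> \<or> eventually (\<lambda>i. \<not> P i) \<U>)"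

text \<open>Meaningful for nonempty bounded sets.\<close>

definition hausdorff_distance :: "'a::metric_space set \<Rightarrow> 'a set \<Rightarrow> real" where
  "hausdorff_distance A B = max (SUP a\<in>A. infdist a B) (SUP b\<in>B. infdist b A)"

end

theory Submission
  imports Defs "HOL-Complex_Analysis.Cauchy_Integral_Formula"
begin

text \<open>For every \<open>n\<close> and \<open>\<mu>\<close> a sentence measures how far \<open>(H,T)\<close> is from containing \<open>n\<close> orthonormal
  eigenvectors for \<open>\<mu>\<close>; its value is continuous in the logic topology, so almost orthonormal almost
  eigenvectors are transferred between the limit and the models along the ultrafilter.

  For \<open>n = 1\<close> these vectors detect the spectrum: if \<open>T\<close> is normal and the disc of radius \<open>r\<close> about \<open>\<mu>\<close>
  misses the spectrum, then \<open>r \<parallel>x\<parallel> \<le> \<parallel>Tx - \<mu>x\<parallel>\<close> (Cauchy estimates for the resolvent), and this bound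
  does not depend on the operator. With compactness this gives the Hausdorff convergence.

  For general \<open>n\<close> they detect multiplicities. In a model, the spectral projection of a disc moves an
  almost eigenvector only slightly, and the vectors in its range are almost eigenvectors, with an
  error proportional to the radius. In the limit, \<open>\<mu>\<close> is isolated in the spectrum, so \<open>T - \<mu>\<close> is bounded
  below on the orthogonal complement of the eigenspace and almost eigenvectors are close to
  eigenvectors. In both cases almost orthonormal vectors stay almost orthonormal, hence linearly
  independent.\<close>

section \<open>Complex inner product spaces\<close>

text \<open>The obstacle is uniformity: only constants depending on a radius and on \<open>n\<close>
  survive the passage along the ultrafilter, so the lower bound off the spectrum must be the
  distance itself and not an unspecified reciprocal of a resolvent norm. A spectral measure is given
  only for the models \<open>(Hs i, Ts i)\<close> and not for the limit, so the eigenspace of an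
  isolated point has to be split off with the resolvent bound alone; in the models the spectral
  measure knows \<open>T\<close> only through \<open>cinner (T x) x\<close>. In both places an
  estimate of a quadratic form becomes an operator estimate by polarization. This costs a factor
  two, visible in \<open>2 / r\<close> and in \<open>2 * \<delta>\<close>, which is harmless since
  tolerances may be taken small. Dimensions are compared by showing that the same finite
  \<open>n\<close> satisfy \<open>enat n \<le> _\<close>: such an inequality concerns
  \<open>n\<close> vectors at a time, which is what a sentence can express, and it covers infinite
  dimensions as well.\<close>

lemma cinner_add_right: "cinner x (y + z) = cinner x y + cinner x (z::'a::complex_inner_space)"
  by (metis cinner_add_left cinner_commute complex_cnj_add)

lemma cinner_scaleC_right: "cinner x (c *\<^sub>C y) = cnj c * cinner x (y::'a::complex_inner_space)"
  by (metis cinner_commute cinner_scaleC_left complex_cnj_mult)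

lemma cinner_scaleR_left: "cinner (r *\<^sub>R x) y = r *\<^sub>R cinner x (y::'a::complex_inner_space)"
  by (simp add: scaleR_scaleC cinner_scaleC_left scaleR_conv_of_real)

lemma cinner_scaleR_right: "cinner x (r *\<^sub>R y) = r *\<^sub>R cinner x (y::'a::complex_inner_space)"
  by (simp add: scaleR_scaleC cinner_scaleC_right scaleR_conv_of_real)

lemma cinner_self: "cinner x x = complex_of_real ((norm (x::'a::complex_inner_space))\<^sup>2)"
proof -
  have "Re (cinner x x) = (norm x)\<^sup>2"
    by (simp add: inner_eq_Re_cinner[symmetric] power2_norm_eq_inner)
  moreover have "Im (cinner x x) = 0"
    using arg_cong[OF cinner_commute[of x x], of Im] by simp
  ultimately show ?thesis by (simp add: complex_eq_iff)
qed

lemma norm_eq_one_if_cinner_self: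
  assumes "cinner x x = 1"
  shows "norm (x::'a::complex_inner_space) = 1"
proof -
  have "(norm x)\<^sup>2 = 1" using assms unfolding cinner_self by (simp only: of_real_eq_1_iff)
  then show ?thesis using norm_ge_zero[of x] by (auto simp: power2_eq_1_iff)
qed

lemma norm_scaleC: "norm (c *\<^sub>C x) = cmod c * norm (x::'a::complex_inner_space)"
proof -
  have "complex_of_real ((norm (c *\<^sub>C x))\<^sup>2) = c * cnj c * complex_of_real ((norm x)\<^sup>2)"
    unfolding cinner_self[symmetric] by (simp add: cinner_scaleC_left cinner_scaleC_right)
  also have "\<dots> = complex_of_real ((cmod c * norm x)\<^sup>2)"
    by (simp add: complex_norm_square[symmetric] power_mult_distrib)
  finally have "(norm (c *\<^sub>C x))\<^sup>2 = (cmod c * norm x)\<^sup>2"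
    using of_real_eq_iff by blast
  then show ?thesis by (simp add: power2_eq_iff_nonneg)
qed

lemma cmod_cinner_le: "cmod (cinner x y) \<le> norm x * norm (y::'a::complex_inner_space)"
proof (cases "cinner x y = 0")
  case False
  \<comment> \<open>The unit scalar \<open>u\<close> turns \<open>cinner x y\<close> into its
    modulus, so the real Cauchy-Schwarz inequality for \<open>u *\<^sub>C x\<close> and
    \<open>y\<close> suffices.\<close>
  define u where "u = cnj (sgn (cinner x y))"
  have u: "cmod u = 1" using False by (simp add: u_def norm_sgn)
  have "u * cinner x y = complex_of_real (cmod (cinner x y))"
    using False complex_norm_square[of "cinner x y"]
    by (simp add: u_def sgn_div_norm scaleR_conv_of_real field_simps power2_eq_square)
  then have "cmod (cinner x y) = inner (u *\<^sub>C x) y"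
    by (simp add: inner_eq_Re_cinner cinner_scaleC_left)
  also have "\<dots> \<le> norm x * norm y"
    using norm_cauchy_schwarz[of "u *\<^sub>C x" y] u by (simp add: norm_scaleC)
  finally show ?thesis .
qed auto

interpretation cinner: bounded_bilinear "cinner :: 'a::complex_inner_space \<Rightarrow> 'a \<Rightarrow> complex"
  by unfold_locales
    (auto simp: cinner_add_left cinner_add_right cinner_scaleR_left cinner_scaleR_right
      intro!: exI[of _ 1] cmod_cinner_le)

interpretation scaleC: bounded_bilinear "scaleC :: complex \<Rightarrow> 'a \<Rightarrow> 'a::complex_inner_space"
  by unfold_locales
    (auto simp: scaleC_add_left scaleC_add_right scaleR_scaleC scaleC_scaleC scaleR_conv_of_real
      mult.commute norm_scaleC intro!: exI[of _ 1])

lemmas cinner_simps = cinner.add_left cinner.add_right cinner.diff_left cinner.diff_right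
  cinner.minus_left cinner.minus_right cinner_scaleC_left cinner_scaleC_right
  cinner_scaleR_left cinner_scaleR_right

lemma cinner_zero_commute: "cinner x y = 0 \<longleftrightarrow> cinner y x = (0::complex)"
  by (metis cinner_commute complex_cnj_zero)

lemma norm_add_cinner_zero:
  fixes x y :: "'a::complex_inner_space"
  assumes "cinner x y = 0"
  shows "(norm (x + y))\<^sup>2 = (norm x)\<^sup>2 + (norm y)\<^sup>2"
  using assms cinner_zero_commute[of y x]
  by (simp add: power2_norm_eq_inner inner_eq_Re_cinner cinner_simps)

section \<open>Nearest points and orthogonal projections\<close>

lemma parallelogram_law:
  fixes x y :: "'a::real_inner"
  shows "(norm (x + y))\<^sup>2 + (norm (x - y))\<^sup>2 = 2 * (norm x)\<^sup>2 + 2 * (norm y)\<^sup>2"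
  by (simp add: power2_norm_eq_inner inner_simps)

lemma csubspace_scaleR: "csubspace V \<Longrightarrow> x \<in> V \<Longrightarrow> r *\<^sub>R x \<in> V"
  by (simp add: scaleR_scaleC complex_vector.subspace_scale)

text \<open>A minimizing sequence is Cauchy: midpoints stay in \<open>V\<close>, so by the
  parallelogram law two almost nearest points cannot be far apart.\<close>

lemma ex_nearest_point:
  fixes x :: "'a::complex_hilbert_space"
  assumes V: "csubspace V" and "closed V"
  shows "\<exists>v\<in>V. \<forall>w\<in>V. norm (x - v) \<le> norm (x - w)"
proof -
  define d where "d = (INF v\<in>V. (norm (x - v))\<^sup>2)"
  have V0: "0 \<in> V" using V by (rule complex_vector.subspace_0)
  have bdd: "bdd_below ((\<lambda>v. (norm (x - v))\<^sup>2) ` V)"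
    by (rule bdd_belowI2[of _ 0]) simp
  have d_le: "d \<le> (norm (x - v))\<^sup>2" if "v \<in> V" for v
    unfolding d_def using bdd that by (rule cINF_lower)
  have "\<exists>v\<in>V. (norm (x - v))\<^sup>2 < d + 1 / Suc n" for n
    using V0 bdd cINF_less_iff[of V "\<lambda>v. (norm (x - v))\<^sup>2" "d + 1 / Suc n"]
    by (auto simp: d_def)
  then obtain v where vV: "\<And>n. v n \<in> V" and v: "\<And>n. (norm (x - v n))\<^sup>2 < d + 1 / Suc n"
    by metis
  have dist_v: "(norm (v n - v k))\<^sup>2 \<le> 2 / Suc n + 2 / Suc k" for n k
  proof -
    have "(1/2) *\<^sub>R (v n + v k) \<in> V"
      using vV V by (intro csubspace_scaleR complex_vector.subspace_add)
    then have "d \<le> (norm (x - (1/2) *\<^sub>R (v n + v k)))\<^sup>2" by (rule d_le)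
    moreover have "x - (1/2) *\<^sub>R (v n + v k) = (1/2) *\<^sub>R ((x - v n) + (x - v k))"
    proof -
      have "r *\<^sub>R x + r *\<^sub>R x - r *\<^sub>R (v n + v k) = r *\<^sub>R ((x - v n) + (x - v k))" for r :: real
        by (simp add: algebra_simps)
      from this[of "1/2"] show ?thesis
        using scaleR_left_distrib[of "1/2" "1/2" x] by simp
    qed
    ultimately have "4 * d \<le> (norm ((x - v n) + (x - v k)))\<^sup>2" by (simp add: power_divide)
    moreover have "(norm ((x - v n) + (x - v k)))\<^sup>2 + (norm (v n - v k))\<^sup>2
        = 2 * (norm (x - v n))\<^sup>2 + 2 * (norm (x - v k))\<^sup>2"
      using parallelogram_law[of "x - v n" "x - v k"] by (simp add: norm_minus_commute)
    ultimately show ?thesis using v[of n] v[of k] by simp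
  qed
  have "Cauchy v"
  proof (rule metric_CauchyI)
    fix e :: real assume e: "e > 0"
    obtain N where N: "inverse (of_nat (Suc N)) < e\<^sup>2 / 4"
      using reals_Archimedean[of "e\<^sup>2 / 4"] e by auto
    show "\<exists>M. \<forall>m\<ge>M. \<forall>n\<ge>M. dist (v m) (v n) < e"
    proof (intro exI[of _ N] allI impI)
      fix m n assume "m \<ge> N" "n \<ge> N"
      then have "2 / real (Suc m) \<le> 2 / real (Suc N)" "2 / real (Suc n) \<le> 2 / real (Suc N)"
        by (simp_all add: frac_le)
      then have "(norm (v m - v n))\<^sup>2 < e\<^sup>2"
        using dist_v[of m n] N by (simp add: inverse_eq_divide)
      then show "dist (v m) (v n) < e"
        using e by (simp add: dist_norm power2_less_imp_less)
    qed
  qed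
  then obtain l where l: "v \<longlonglongrightarrow> l"
    using Cauchy_convergent convergent_def by blast
  have lV: "l \<in> V" using closed_sequentially[OF \<open>closed V\<close>] vV l by blast
  have lim: "(\<lambda>n. d + 1 / real (Suc n)) \<longlonglongrightarrow> d + 0"
    by (intro tendsto_add tendsto_const LIMSEQ_Suc[OF lim_1_over_n])
  have "(\<lambda>n. (norm (x - v n))\<^sup>2) \<longlonglongrightarrow> (norm (x - l))\<^sup>2"
    by (intro tendsto_intros l)
  then have "(norm (x - l))\<^sup>2 \<le> d + 0"
    using lim by (rule LIMSEQ_le) (meson v less_imp_le)
  then have "norm (x - l) \<le> norm (x - w)" if "w \<in> V" for w
    using d_le[OF that] by (intro power2_le_imp_le[OF _ norm_ge_zero]) linarith
  then show ?thesis using lV by blast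
qed

text \<open>The distance is stationary at the nearest point in every direction \<open>w\<close> of
  \<open>V\<close>, which kills the real part of \<open>cinner (x - v) w\<close>; the direction
  \<open>\<i> *\<^sub>C w\<close> kills the imaginary part.\<close>

lemma ex_orthogonal_projection:
  fixes x :: "'a::complex_hilbert_space"
  assumes V: "csubspace V" and "closed V"
  shows "\<exists>v\<in>V. \<forall>w\<in>V. cinner (x - v) w = 0"
proof -
  obtain v where v: "v \<in> V" and le: "\<And>w. w \<in> V \<Longrightarrow> norm (x - v) \<le> norm (x - w)"
    using ex_nearest_point[OF assms] by blast
  have inner0: "inner (x - v) w = 0" if w: "w \<in> V" for w
  proof (cases "w = 0")
    case False
    define t where "t = inner (x - v) w / (norm w)\<^sup>2"
    have "(norm (x - v))\<^sup>2 \<le> (norm (x - (v + t *\<^sub>R w)))\<^sup>2"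
      using le[of "v + t *\<^sub>R w"] v w V
      by (simp add: complex_vector.subspace_add csubspace_scaleR)
    also have "\<dots> = (norm ((x - v) - t *\<^sub>R w))\<^sup>2" by (simp add: algebra_simps)
    also have "\<dots> = (norm (x - v))\<^sup>2 - 2 * t * inner (x - v) w + t\<^sup>2 * (norm w)\<^sup>2"
      unfolding power2_norm_eq_inner inner_diff_left inner_diff_right
      by (simp add: inner_commute power2_eq_square algebra_simps)
    also have "\<dots> = (norm (x - v))\<^sup>2 - (inner (x - v) w)\<^sup>2 / (norm w)\<^sup>2"
      using False by (simp add: t_def field_simps power2_eq_square)
    finally show ?thesis
      using False by (simp add: divide_le_0_iff)
  qed simp
  have "cinner (x - v) w = 0" if w: "w \<in> V" for w
  proof -
    have "inner (x - v) (\<i> *\<^sub>C w) = 0"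
      using inner0 complex_vector.subspace_scale[OF V w] by blast
    then show ?thesis using inner0[OF w]
      by (simp add: inner_eq_Re_cinner cinner_scaleC_right complex_eq_iff)
  qed
  then show ?thesis using v by blast
qed

section \<open>Dimensions\<close>

lemma cdim_ge_card_independent:
  fixes V :: "'a::complex_hilbert_space set"
  assumes "complex_vector.independent S" and "S \<subseteq> V" and "finite S"
  shows "enat (card S) \<le> cdim V"
proof (cases "\<exists>B. finite B \<and> V \<subseteq> cspan B")
  case True
  then obtain B where B: "finite B" "V \<subseteq> cspan B" by blast
  obtain C where C: "C \<subseteq> V" "complex_vector.independent C" "V \<subseteq> cspan C" "card C = cdim_nat V"
    using complex_vector.basis_exists by metis
  have "finite C"
    using complex_vector.independent_span_bound[OF B(1) C(2)] C(1) B(2) by blast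
  then have "card S \<le> card C"
    using complex_vector.independent_span_bound[OF _ assms(1)] assms(2) C(3) by blast
  then show ?thesis using True C(4) by (simp add: cdim_def)
qed (auto simp: cdim_def)

text \<open>Diagonal dominance of the Gram matrix: pairing a vanishing combination with the vector
  whose coefficient has the largest modulus \<open>M\<close> gives
  \<open>M \<le> real n * \<eta> * M\<close>, so \<open>M\<close> vanishes.\<close>

lemma almost_orthonormal_cdim_ge:
  fixes V :: "'a::complex_hilbert_space set" and x :: "nat \<Rightarrow> 'a"
  assumes V: "csubspace V" and x: "\<And>j. j < n \<Longrightarrow> x j \<in> V"
    and \<eta>: "\<And>i j. i < n \<Longrightarrow> j < n \<Longrightarrow> cmod (cinner (x i) (x j) - of_bool (i = j)) \<le> \<eta>"
    and n\<eta>: "real n * \<eta> < 1"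
  shows "enat n \<le> cdim V"
proof -
  have triv: "\<forall>j<n. c j = 0" if c: "(\<Sum>j<n. c j *\<^sub>C x j) = 0" for c :: "nat \<Rightarrow> complex"
  proof (cases "n = 0")
    case False
    define M where "M = Max ((\<lambda>j. cmod (c j)) ` {..<n})"
    have M: "cmod (c j) \<le> M" if "j < n" for j
      using that by (auto simp: M_def)
    have "M \<in> (\<lambda>j. cmod (c j)) ` {..<n}"
      unfolding M_def using False by (intro Max_in) auto
    then obtain k where k: "k < n" "M = cmod (c k)" by auto
    have "0 = cinner (\<Sum>j<n. c j *\<^sub>C x j) (x k)" by (simp add: c cinner.zero_left)
    also have "\<dots> = (\<Sum>j<n. c j * cinner (x j) (x k))"
      by (simp add: cinner.sum_left cinner_scaleC_left)
    also have "\<dots> = (\<Sum>j<n. c j * (cinner (x j) (x k) - of_bool (j = k)) + (if j = k then c j else 0))"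
      by (intro sum.cong) (auto simp: algebra_simps)
    also have "\<dots> = (\<Sum>j<n. c j * (cinner (x j) (x k) - of_bool (j = k))) + c k"
      using k by (simp add: sum.distrib)
    finally have "c k = - (\<Sum>j<n. c j * (cinner (x j) (x k) - of_bool (j = k)))"
      by (simp add: eq_neg_iff_add_eq_0 add.commute)
    then have "M \<le> (\<Sum>j<n. cmod (c j * (cinner (x j) (x k) - of_bool (j = k))))"
      using k norm_sum[of "\<lambda>j. c j * (cinner (x j) (x k) - of_bool (j = k))" "{..<n}"] by simp
    also have "\<dots> \<le> (\<Sum>j<n. M * \<eta>)"
    proof (rule sum_mono)
      fix j assume "j \<in> {..<n}"
      then show "cmod (c j * (cinner (x j) (x k) - of_bool (j = k))) \<le> M * \<eta>"
        using M[of j] \<eta>[of j k] k by (simp only: norm_mult lessThan_iff) (intro mult_mono, auto)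
    qed
    finally have "M * (1 - real n * \<eta>) \<le> 0" by (simp add: algebra_simps)
    then have "M \<le> 0" using n\<eta> by (simp add: mult_le_0_iff)
    then show ?thesis using M order_trans[OF M] by fastforce
  qed simp
  \<comment> \<open>Independence is a property of the image set, which would be too small if two of
    the vectors coincided.\<close>
  have inj: "inj_on x {..<n}"
  proof (rule inj_onI, rule ccontr)
    fix i j assume ij: "i \<in> {..<n}" "j \<in> {..<n}" "x i = x j" "i \<noteq> j"
    let ?c = "\<lambda>k. if k = i then 1 else if k = j then -1 else 0 :: complex"
    have "(\<Sum>k<n. ?c k *\<^sub>C x k) = (\<Sum>k<n. (if k = i then x i else 0) + (if k = j then - x j else 0))"
      using ij by (intro sum.cong) (auto simp: scaleC_one complex_vector.scale_minus_left)
    also have "\<dots> = 0" using ij by (simp add: sum.distrib)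
    finally have "\<forall>k<n. ?c k = 0" by (rule triv)
    then have "?c i = 0" using ij(1) by blast
    then show False by simp
  qed
  have "complex_vector.independent (x ` {..<n})"
  proof (rule complex_vector.independent_if_scalars_zero)
    fix f v assume f: "(\<Sum>v\<in>x ` {..<n}. f v *\<^sub>C v) = 0" and v: "v \<in> x ` {..<n}"
    then have "(\<Sum>j<n. f (x j) *\<^sub>C x j) = 0" using inj by (simp add: sum.reindex)
    then show "f v = 0" using triv[of "\<lambda>j. f (x j)"] v by auto
  qed simp
  from cdim_ge_card_independent[OF this, of V] show ?thesis
    using x inj by (auto simp: card_image)
qed

lemma card_spanning_ge:
  assumes "finite B" "V \<subseteq> cspan B" "enat n \<le> cdim V"
  shows "n \<le> card B"
proof -
  have "cdim V = enat (cdim_nat V)" using assms by (auto simp: cdim_def)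
  then show ?thesis using complex_vector.dim_le_card[OF assms(2,1)] assms(3) by simp
qed

text \<open>Gram-Schmidt one vector at a time: \<open>n\<close> vectors cannot span \<open>V\<close>
  when \<open>enat (Suc n) \<le> cdim V\<close>, so some \<open>v\<close> in \<open>V\<close> has a
  nonzero component orthogonal to them.\<close>

lemma ex_orthonormal_family:
  fixes V :: "'a::complex_hilbert_space set"
  assumes V: "csubspace V" and "enat n \<le> cdim V"
  shows "\<exists>x. (\<forall>j<n. x j \<in> V) \<and> (\<forall>i<n. \<forall>j<n. cinner (x i) (x j) = of_bool (i = j))"
  using assms(2)
proof (induction n)
  case (Suc n)
  have "enat n \<le> cdim V" using Suc.prems order_trans[of "enat n" "enat (Suc n)"] by simp
  then obtain x where x: "\<forall>j<n. x j \<in> V" "\<forall>i<n. \<forall>j<n. cinner (x i) (x j) = of_bool (i = j)"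
    using Suc.IH by blast
  have "card (x ` {..<n}) \<le> n" using card_image_le[of "{..<n}" x] by simp
  then have "\<not> V \<subseteq> cspan (x ` {..<n})"
    using card_spanning_ge[of "x ` {..<n}" V "Suc n"] Suc.prems by auto
  then obtain v where v: "v \<in> V" "v \<notin> cspan (x ` {..<n})" by blast
  define p where "p = (\<Sum>j<n. cinner v (x j) *\<^sub>C x j)"
  define u where "u = v - p"
  have "p \<in> cspan (x ` {..<n})"
    unfolding p_def by (intro complex_vector.span_sum complex_vector.span_scale complex_vector.span_base) auto
  then have "u \<noteq> 0" using v by (auto simp: u_def)
  have "p \<in> V" unfolding p_def using V x(1)
    by (intro complex_vector.subspace_sum complex_vector.subspace_scale) auto
  then have uV: "u \<in> V" using v V by (simp add: u_def complex_vector.subspace_diff)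
  have ux: "cinner u (x k) = 0" if k: "k < n" for k
  proof -
    have "cinner p (x k) = (\<Sum>j<n. if j = k then cinner v (x j) else 0)"
      unfolding p_def cinner.sum_left cinner_scaleC_left using x(2) k by (intro sum.cong) auto
    then show ?thesis using k by (simp add: u_def cinner.diff_left)
  qed
  define w where "w = (1 / norm u) *\<^sub>R u"
  have "cinner w w = 1"
    using \<open>u \<noteq> 0\<close> by (simp add: w_def cinner_self)
  moreover have "cinner w (x k) = 0" "cinner (x k) w = 0" if "k < n" for k
    using ux[OF that] cinner_zero_commute[of u "x k"]
    by (simp_all add: w_def cinner_scaleR_left cinner_scaleR_right)
  moreover have "w \<in> V" using uV V by (simp add: w_def csubspace_scaleR)
  ultimately show ?case using x
    by (intro exI[of _ "x(n := w)"]) (auto simp: less_Suc_eq)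
qed simp

section \<open>Extended natural numbers and their limits along an ultrafilter\<close>

lemma enat_le_limit_iff:
  fixes g :: "'i \<Rightarrow> enat"
  assumes "(g \<longlongrightarrow> L) F" "F \<noteq> bot"
  shows "enat n \<le> L \<longleftrightarrow> eventually (\<lambda>i. enat n \<le> g i) F"
proof
  assume L: "enat n \<le> L"
  show "eventually (\<lambda>i. enat n \<le> g i) F"
  proof (cases n)
    case 0
    then show ?thesis by (simp add: zero_enat_def[symmetric])
  next
    case (Suc k)
    \<comment> \<open>For extended naturals, being at least \<open>Suc k\<close> is the same as
      exceeding \<open>k\<close>, which is an open condition.\<close>
    then have "enat k < L" using L by (meson enat_ord_simps(2) less_le_trans lessI)
    then have "eventually (\<lambda>i. enat k < g i) F" using order_tendstoD(1)[OF assms(1)] by blast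
    then show ?thesis
      by eventually_elim (simp add: Suc eSuc_enat[symmetric] ileI1)
  qed
next
  assume "eventually (\<lambda>i. enat n \<le> g i) F"
  then show "enat n \<le> L" using assms tendsto_lowerbound by blast
qed

text \<open>Either some finite value is attained almost everywhere, or the ultrafilter avoids every
  finite value and the limit is \<open>\<infinity>\<close>. This makes \<open>Lim\<close> in the
  theorem a genuine limit.\<close>

lemma ultrafilter_enat_convergent:
  fixes g :: "'i \<Rightarrow> enat"
  assumes "ultrafilter \<U>"
  shows "\<exists>L. (g \<longlongrightarrow> L) \<U>"
proof (cases "\<exists>n. eventually (\<lambda>i. g i = enat n) \<U>")
  case True
  then show ?thesis using tendsto_eventually by fast
next
  case False
  then have ne: "eventually (\<lambda>i. g i \<noteq> enat n) \<U>" for n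
    using assms unfolding ultrafilter_def by blast
  have "eventually (\<lambda>i. \<forall>k\<in>{..n}. g i \<noteq> enat k) \<U>" for n
    using ne by (simp add: eventually_ball_finite)
  moreover have "enat n < a" if "\<forall>k\<in>{..n}. a \<noteq> enat k" for n a
    using that by (cases a) auto
  ultimately have "eventually (\<lambda>i. enat n < g i) \<U>" for n
    by (rule eventually_mono)
  then have "(g \<longlongrightarrow> \<infinity>) \<U>"
    by (intro order_tendstoI) (metis less_infinityE, simp)
  then show ?thesis by blast
qed

lemma enat_le_Lim_iff:
  fixes g :: "'i \<Rightarrow> enat"
  assumes "ultrafilter \<U>"
  shows "enat n \<le> Lim \<U> g \<longleftrightarrow> eventually (\<lambda>i. enat n \<le> g i) \<U>"
proof -
  obtain L where L: "(g \<longlongrightarrow> L) \<U>" using ultrafilter_enat_convergent[OF assms] by blast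
  moreover have "\<U> \<noteq> bot" using assms by (simp add: ultrafilter_def)
  ultimately show ?thesis using enat_le_limit_iff tendsto_Lim by metis
qed

lemma enat_eqI_le:
  assumes "\<And>n. enat n \<le> a \<longleftrightarrow> enat n \<le> b"
  shows "a = b"
proof -
  have le: "c \<le> d" if "\<And>n. enat n \<le> c \<Longrightarrow> enat n \<le> d" for c d
  proof (cases c)
    case infinity
    \<comment> \<open>If \<open>d\<close> were finite, its successor would be a finite number that
      is at most \<open>c\<close> but exceeds \<open>d\<close>.\<close>
    then show ?thesis using that[of "Suc (the_enat d)"] by (cases d) auto
  qed (use that in auto)
  show ?thesis
  proof (rule antisym)
    show "a \<le> b" by (rule le) (simp only: assms)
    show "b \<le> a" by (rule le) (simp only: assms)
  qed
qed

section \<open>Normal operators\<close>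

text \<open>The adjoint is a parameter so that \<open>T - \<mu>\<close> can be interpreted as an
  instance with its own adjoint.\<close>

locale normal_operator =
  fixes H :: "'a::complex_hilbert_space set" and T S :: "'a \<Rightarrow> 'a"
  assumes csubspace: "csubspace H" and closed: "closed H"
    and bounded: "bounded_op_on H T" and adjoint: "is_adjoint_on H T S"
    and commute: "\<And>x. x \<in> H \<Longrightarrow> S (T x) = T (S x)"
begin

lemma bounded_adjoint: "bounded_op_on H S"
  using adjoint by (simp add: is_adjoint_on_def)

lemma mem_H [simp, intro]:
  "0 \<in> H" "x \<in> H \<Longrightarrow> y \<in> H \<Longrightarrow> x + y \<in> H" "x \<in> H \<Longrightarrow> y \<in> H \<Longrightarrow> x - y \<in> H"
  "x \<in> H \<Longrightarrow> c *\<^sub>C x \<in> H" "x \<in> H \<Longrightarrow> r *\<^sub>R x \<in> H" "x \<in> H \<Longrightarrow> T x \<in> H" "x \<in> H \<Longrightarrow> S x \<in> H"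
  using csubspace bounded bounded_adjoint
  by (auto intro: complex_vector.subspace_0 complex_vector.subspace_add complex_vector.subspace_diff
      complex_vector.subspace_scale csubspace_scaleR simp: bounded_op_on_def linear_op_on_def)

lemma T_add: "x \<in> H \<Longrightarrow> y \<in> H \<Longrightarrow> T (x + y) = T x + T y"
  and T_scaleC: "x \<in> H \<Longrightarrow> T (c *\<^sub>C x) = c *\<^sub>C T x"
  and S_add: "x \<in> H \<Longrightarrow> y \<in> H \<Longrightarrow> S (x + y) = S x + S y"
  and S_scaleC: "x \<in> H \<Longrightarrow> S (c *\<^sub>C x) = c *\<^sub>C S x"
  using bounded bounded_adjoint by (auto simp: bounded_op_on_def linear_op_on_def)

lemma T_scaleR: "x \<in> H \<Longrightarrow> T (r *\<^sub>R x) = r *\<^sub>R T x"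
  by (simp add: scaleR_scaleC T_scaleC)

lemma T_diff: "x \<in> H \<Longrightarrow> y \<in> H \<Longrightarrow> T (x - y) = T x - T y"
  using T_add[of "x - y" y] by simp

lemma S_diff: "x \<in> H \<Longrightarrow> y \<in> H \<Longrightarrow> S (x - y) = S x - S y"
  using S_add[of "x - y" y] by simp

lemma T_zero [simp]: "T 0 = 0"
  using T_add[of 0 0] by simp

lemma cinner_T: "x \<in> H \<Longrightarrow> y \<in> H \<Longrightarrow> cinner (T x) y = cinner x (S y)"
  using adjoint by (simp add: is_adjoint_on_def)

text \<open>Normality is used in this form: moving \<open>T\<close> across and commuting turns
  \<open>cinner (T x) (T x)\<close> into the conjugate of \<open>cinner (S x) (S x)\<close>.\<close>

lemma norm_adjoint:
  assumes "x \<in> H"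
  shows "norm (S x) = norm (T x)"
proof -
  have "cinner (T x) (T x) = cinner x (T (S x))"
    using assms cinner_T[of x "T x"] commute[of x] by simp
  also have "\<dots> = cnj (cinner (S x) (S x))"
    using assms cinner_T[of "S x" x] cinner_commute[of x "T (S x)"] by simp
  finally have "complex_of_real ((norm (T x))\<^sup>2) = complex_of_real ((norm (S x))\<^sup>2)"
    by (simp add: cinner_self)
  then have "(norm (T x))\<^sup>2 = (norm (S x))\<^sup>2" using of_real_eq_iff by blast
  then show ?thesis by (simp add: power2_eq_iff_nonneg)
qed

text \<open>Cauchy-Schwarz for \<open>cinner x (S (T x))\<close>, with \<open>S\<close> replaced by
  \<open>T\<close> inside the norm. Along an orbit this is log-convexity of the norms, needed later
  for orbits of the resolvent.\<close>

lemma norm_T_squared_le: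
  assumes "x \<in> H"
  shows "(norm (T x))\<^sup>2 \<le> norm (T (T x)) * norm x"
proof -
  have "complex_of_real ((norm (T x))\<^sup>2) = cinner x (S (T x))"
    using assms cinner_T[of x "T x"] by (simp add: cinner_self)
  then have "(norm (T x))\<^sup>2 = cmod (cinner x (S (T x)))"
    by (metis abs_power2 norm_of_real power_abs abs_norm_cancel)
  also have "\<dots> \<le> norm x * norm (T (T x))"
    using cmod_cinner_le[of x "S (T x)"] norm_adjoint[of "T x"] assms by simp
  finally show ?thesis by (simp add: mult.commute)
qed

lemma continuous_on_T: "continuous_on H T"
proof -
  obtain c where c: "\<And>x. x \<in> H \<Longrightarrow> norm (T x) \<le> c * norm x"
    using bounded by (auto simp: bounded_op_on_def)
  have "dist (T x) (T y) \<le> \<bar>c\<bar> * dist x y" if "x \<in> H" "y \<in> H" for x y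
    using c[of "x - y"] that T_diff[of x y] mult_right_mono[OF abs_ge_self[of c], of "norm (x - y)"]
    by (simp add: dist_norm)
  then have "\<bar>c\<bar>-lipschitz_on H T" by (intro lipschitz_onI) auto
  then show ?thesis by (rule lipschitz_on_continuous_on)
qed

lemma csubspace_range: "csubspace (T ` H)"
  unfolding complex_vector.subspace_def
proof (intro conjI allI ballI)
  show "0 \<in> T ` H" using T_zero by (metis image_eqI mem_H(1))
  show "x + y \<in> T ` H" if "x \<in> T ` H" "y \<in> T ` H" for x y
    using that T_add by (auto simp: image_iff) (metis mem_H(2))
  show "c *\<^sub>C x \<in> T ` H" if "x \<in> T ` H" for c x
    using that T_scaleC by (auto simp: image_iff) (metis mem_H(4))
qed

text \<open>The orthogonal complement of the range is the kernel of the adjoint, and for a normal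
  operator this is the kernel of \<open>T\<close>.\<close>

lemma orthogonal_range:
  assumes "y \<in> H" and "\<And>x. x \<in> H \<Longrightarrow> cinner y (T x) = 0"
  shows "T y = 0"
proof -
  have "cinner (S y) (S y) = 0"
    using assms cinner_T[of "S y" y] cinner_zero_commute[of y "T (S y)"] by simp
  then have "S y = 0" by (simp add: cinner_self)
  then show ?thesis using norm_adjoint[OF assms(1)] by simp
qed

text \<open>The lower bound makes the range closed and the kernel trivial, and by normality the
  complement of the range lies in the kernel.\<close>

lemma surj_if_bounded_below:
  assumes c: "c > 0" and below: "\<And>x. x \<in> H \<Longrightarrow> c * norm x \<le> norm (T x)"
  shows "T ` H = H"
proof -
  have "closed (T ` H)"
    unfolding closed_sequential_limits
  proof (intro allI impI, elim conjE)
    fix f l assume f: "\<forall>n. f n \<in> T ` H" and l: "f \<longlonglongrightarrow> l"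
    from f obtain g where gH: "\<And>n. g n \<in> H" and g: "\<And>n. f n = T (g n)"
      by (auto simp: image_iff) metis
    have "Cauchy g"
    proof (rule metric_CauchyI)
      fix e :: real assume "e > 0"
      then obtain N where N: "\<And>m n. m \<ge> N \<Longrightarrow> n \<ge> N \<Longrightarrow> dist (f m) (f n) < c * e"
        using metric_CauchyD[OF LIMSEQ_imp_Cauchy[OF l], of "c * e"] c by auto
      have "dist (g m) (g n) < e" if "m \<ge> N" "n \<ge> N" for m n
      proof -
        have "c * dist (g m) (g n) \<le> dist (f m) (f n)"
          using below[of "g m - g n"] gH T_diff by (simp add: g dist_norm)
        also have "\<dots> < c * e" using N that by blast
        finally show ?thesis using c by simp
      qed
      then show "\<exists>M. \<forall>m\<ge>M. \<forall>n\<ge>M. dist (g m) (g n) < e" by blast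
    qed
    then obtain x where x: "g \<longlonglongrightarrow> x" using Cauchy_convergent convergent_def by blast
    have xH: "x \<in> H" using closed_sequentially[OF closed] gH x by blast
    have "(\<lambda>n. T (g n)) \<longlonglongrightarrow> T x"
      using continuous_on_T x xH gH by (auto simp: continuous_on_sequentially comp_def)
    moreover have "f = (\<lambda>n. T (g n))" using g by blast
    ultimately have "l = T x" using l LIMSEQ_unique by blast
    then show "l \<in> T ` H" using xH by blast
  qed
  moreover have "y \<in> T ` H" if closed: "closed (T ` H)" and y: "y \<in> H" for y
  proof -
    obtain v where v: "v \<in> T ` H" "\<And>w. w \<in> T ` H \<Longrightarrow> cinner (y - v) w = 0"
      using ex_orthogonal_projection[OF csubspace_range closed] by blast
    have yv: "y - v \<in> H" using v(1) y by auto
    have "T (y - v) = 0" by (rule orthogonal_range[OF yv]) (use v in blast)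
    then have "norm (y - v) = 0" using below[OF yv] c by (simp add: mult_le_0_iff)
    then show ?thesis using v by simp
  qed
  ultimately show ?thesis by auto
qed

lemma shift: "normal_operator H (\<lambda>x. T x - \<mu> *\<^sub>C x) (\<lambda>x. S x - cnj \<mu> *\<^sub>C x)"
proof
  have bd: "bounded_op_on H (\<lambda>x. U x - \<nu> *\<^sub>C x)" if U: "bounded_op_on H U" for U \<nu>
  proof -
    obtain c where c: "\<And>x. x \<in> H \<Longrightarrow> norm (U x) \<le> c * norm x"
      using U by (auto simp: bounded_op_on_def)
    have "norm (U x - \<nu> *\<^sub>C x) \<le> (c + cmod \<nu>) * norm x" if "x \<in> H" for x
      using norm_triangle_ineq4[of "U x" "\<nu> *\<^sub>C x"] c[OF that] by (simp add: norm_scaleC algebra_simps)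
    moreover have "linear_op_on H (\<lambda>x. U x - \<nu> *\<^sub>C x)"
      using U by (auto simp: bounded_op_on_def linear_op_on_def scaleC_add_right scaleC_scaleC
          scaleC.diff_right mult.commute)
    ultimately show ?thesis by (auto simp: bounded_op_on_def)
  qed
  show "bounded_op_on H (\<lambda>x. T x - \<mu> *\<^sub>C x)" by (rule bd[OF bounded])
  show "is_adjoint_on H (\<lambda>x. T x - \<mu> *\<^sub>C x) (\<lambda>x. S x - cnj \<mu> *\<^sub>C x)"
    unfolding is_adjoint_on_def using bd[OF bounded_adjoint] by (auto simp: cinner_simps cinner_T)
  show "S (T x - \<mu> *\<^sub>C x) - cnj \<mu> *\<^sub>C (T x - \<mu> *\<^sub>C x) =
      T (S x - cnj \<mu> *\<^sub>C x) - \<mu> *\<^sub>C (S x - cnj \<mu> *\<^sub>C x)" if "x \<in> H" for x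
    using that by (simp add: S_diff T_diff S_scaleC T_scaleC commute scaleC.diff_right scaleC_scaleC
        mult.commute algebra_simps)
qed (use csubspace closed in auto)

text \<open>With the converse \<open>bounded_below_if_notin_spectrum\<close>, the spectrum is the
  approximate point spectrum. This makes it accessible to sentences, which speak of vectors and not
  of inverses.\<close>

lemma notin_spectrum_if_bounded_below:
  assumes c: "c > 0" and below: "\<And>x. x \<in> H \<Longrightarrow> c * norm x \<le> norm (T x - \<mu> *\<^sub>C x)"
  shows "\<mu> \<notin> spectrum_on H T"
proof -
  interpret M: normal_operator H "\<lambda>x. T x - \<mu> *\<^sub>C x" "\<lambda>x. S x - cnj \<mu> *\<^sub>C x"
    by (rule shift)
  let ?M = "\<lambda>x. T x - \<mu> *\<^sub>C x"
  have inj: "x = y" if "x \<in> H" "y \<in> H" "?M x = ?M y" for x y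
    using below[of "x - y"] that c M.T_diff[of x y] by (simp add: mult_le_0_iff)
  have surj: "\<exists>x\<in>H. ?M x = y" if "y \<in> H" for y
  proof -
    have "y \<in> ?M ` H" using M.surj_if_bounded_below[OF c below] that by blast
    then show ?thesis by blast
  qed
  define R where "R y = (SOME x. x \<in> H \<and> ?M x = y)" for y
  have R: "R y \<in> H" "?M (R y) = y" if "y \<in> H" for y
    using someI_ex[of "\<lambda>x. x \<in> H \<and> ?M x = y"] surj[OF that] unfolding R_def by blast+
  have RM: "R (?M x) = x" if "x \<in> H" for x
    using inj[OF R(1) that R(2)] that by simp
  have "linear_op_on H R"
    unfolding linear_op_on_def
  proof (intro conjI ballI allI)
    fix x y c assume x: "x \<in> H"
    show "R x \<in> H" using R x by blast
    show "R (c *\<^sub>C x) = c *\<^sub>C R x"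
      using RM[of "c *\<^sub>C R x"] M.T_scaleC[of "R x" c] R[OF x] by (simp add: T_scaleC)
    assume y: "y \<in> H"
    show "R (x + y) = R x + R y"
      using RM[of "R x + R y"] M.T_add[of "R x" "R y"] R[OF x] R[OF y] by simp
  qed
  moreover have "norm (R x) \<le> (1 / c) * norm x" if "x \<in> H" for x
    using below[OF R(1)[OF that]] R(2)[OF that] c by (simp add: field_simps)
  ultimately have "bounded_op_on H R" unfolding bounded_op_on_def by blast
  then show ?thesis using R RM unfolding spectrum_on_def by blast
qed

lemma bounded_below_perturb:
  assumes below: "c * norm x \<le> norm (T x - \<mu> *\<^sub>C x)"
  shows "(c - cmod (z - \<mu>)) * norm x \<le> norm (T x - z *\<^sub>C x)"
proof -
  have "T x - \<mu> *\<^sub>C x = (T x - z *\<^sub>C x) + (z - \<mu>) *\<^sub>C x" by (simp add: scaleC.diff_left)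
  then have "norm (T x - \<mu> *\<^sub>C x) \<le> norm (T x - z *\<^sub>C x) + cmod (z - \<mu>) * norm x"
    by (metis norm_scaleC norm_triangle_ineq)
  then show ?thesis using below by (simp add: algebra_simps)
qed

lemma notin_spectrum_near:
  assumes "\<And>x. x \<in> H \<Longrightarrow> c * norm x \<le> norm (T x - \<mu> *\<^sub>C x)" and "cmod (z - \<mu>) < c"
  shows "z \<notin> spectrum_on H T"
  using assms by (intro notin_spectrum_if_bounded_below[OF _ bounded_below_perturb]) auto

lemma bounded_below_if_notin_spectrum:
  assumes "\<mu> \<notin> spectrum_on H T"
  obtains c where "c > 0" "\<And>x. x \<in> H \<Longrightarrow> c * norm x \<le> norm (T x - \<mu> *\<^sub>C x)"
proof -
  obtain R where "bounded_op_on H R" and R: "\<And>x. x \<in> H \<Longrightarrow> R (T x - \<mu> *\<^sub>C x) = x"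
    using assms unfolding spectrum_on_def by blast
  then obtain C where C: "\<And>x. x \<in> H \<Longrightarrow> norm (R x) \<le> C * norm x"
    unfolding bounded_op_on_def by blast
  show thesis
  proof
    show "1 / (\<bar>C\<bar> + 1) > 0" by (simp add: add_nonneg_pos)
    fix x assume x: "x \<in> H"
    have "norm x \<le> C * norm (T x - \<mu> *\<^sub>C x)" using C[of "T x - \<mu> *\<^sub>C x"] R[OF x] x by simp
    also have "\<dots> \<le> (\<bar>C\<bar> + 1) * norm (T x - \<mu> *\<^sub>C x)" by (intro mult_right_mono) auto
    finally show "1 / (\<bar>C\<bar> + 1) * norm x \<le> norm (T x - \<mu> *\<^sub>C x)"
      by (simp add: pos_divide_le_eq add_nonneg_pos mult.commute)
  qed
qed

end

section \<open>The resolvent and the distance to the spectrum\<close>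

text \<open>For a normal operator the orbit norms \<open>\<parallel>R\<^sup>n u\<parallel>\<close> are log-convex in \<open>n\<close>, so a geometric bound on them
  already bounds the first ratio, without any constant. This replaces the spectral radius formula.\<close>

lemma log_convex_le_one:
  fixes a :: "nat \<Rightarrow> real"
  assumes nonneg: "\<And>n. 0 \<le> a n" and convex: "\<And>n. (a (Suc n))\<^sup>2 \<le> a n * a (Suc (Suc n))"
    and bound: "\<And>n. a n \<le> C"
  shows "a 1 \<le> a 0"
proof (rule ccontr)
  assume "\<not> a 1 \<le> a 0"
  then have less: "a 0 < a 1" by simp
  have pos: "0 < a 0"
    using convex[of 0] less nonneg[of 0] by (cases "a 0 = 0") auto
  define q where "q = a 1 / a 0"
  have q: "q > 1" using less pos by (simp add: q_def)
  have step: "0 < a n \<and> q * a n \<le> a (Suc n)" for n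
  proof (induction n)
    case 0
    then show ?case using pos by (simp add: q_def)
  next
    case (Suc n)
    then have "0 < q * a n" using q by simp
    then have pos': "0 < a (Suc n)" using Suc by linarith
    have "a n * (q * a (Suc n)) = (q * a n) * a (Suc n)" by simp
    also have "\<dots> \<le> (a (Suc n))\<^sup>2"
      using Suc pos' by (simp add: power2_eq_square)
    also have "\<dots> \<le> a n * a (Suc (Suc n))" by (rule convex)
    finally show ?case using Suc pos' by simp
  qed
  have "q ^ n * a 0 \<le> a n" for n
  proof (induction n)
    case (Suc n)
    then have "q * (q ^ n * a 0) \<le> q * a n" using q by (intro mult_left_mono) auto
    then show ?case using step[of n] by (simp add: mult.assoc)
  qed simp
  then have "q ^ n \<le> C / a 0" for n
    using bound[of n] pos by (meson order_trans pos_le_divide_eq)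
  then show False using real_arch_pow[OF q, of "C / a 0"] by (meson not_less)
qed

text \<open>\<open>R_mem\<close> is demanded for every \<open>z\<close>, not only in
  \<open>B\<close>, so that limits and powers need no side condition; values off \<open>B\<close>
  are otherwise arbitrary. Boundedness of \<open>R z\<close> is derived, locally uniformly in
  \<open>z\<close>.\<close>

locale resolvent_family = normal_operator H T S
  for H :: "'a::complex_hilbert_space set" and T S :: "'a \<Rightarrow> 'a" +
  fixes B :: "complex set" and R :: "complex \<Rightarrow> 'a \<Rightarrow> 'a"
  assumes open_B: "open B" and spectrum_B: "B \<inter> spectrum_on H T = {}"
    and R_mem [simp, intro]: "y \<in> H \<Longrightarrow> R z y \<in> H"
    and R_left: "z \<in> B \<Longrightarrow> y \<in> H \<Longrightarrow> R z (T y - z *\<^sub>C y) = y"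
    and R_right: "z \<in> B \<Longrightarrow> y \<in> H \<Longrightarrow> T (R z y) - z *\<^sub>C R z y = y"
begin

lemma R_eqI: "z \<in> B \<Longrightarrow> b \<in> H \<Longrightarrow> T b - z *\<^sub>C b = y \<Longrightarrow> R z y = b"
  using R_left by blast

lemma R_scaleC: "z \<in> B \<Longrightarrow> y \<in> H \<Longrightarrow> R z (c *\<^sub>C y) = c *\<^sub>C R z y"
  using R_right[of z y]
  by (intro R_eqI) (auto simp: T_scaleC scaleC_add_right scaleC_scaleC mult.commute diff_eq_eq)

lemma R_diff: "z \<in> B \<Longrightarrow> y \<in> H \<Longrightarrow> y' \<in> H \<Longrightarrow> R z (y - y') = R z y - R z y'"
  using R_right[of z y] R_right[of z y']
  by (intro R_eqI) (auto simp: T_diff scaleC.diff_right algebra_simps)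

lemma resolvent_identity:
  assumes "z \<in> B" "w \<in> B" "y \<in> H"
  shows "R z y - R w y = (z - w) *\<^sub>C R z (R w y)"
proof -
  define b where "b = R w y"
  have b: "b \<in> H" "y = T b - w *\<^sub>C b" using assms R_right[of w y] by (simp_all add: b_def)
  have "y - (T b - z *\<^sub>C b) = (z - w) *\<^sub>C b" by (simp add: b(2) scaleC.diff_left)
  then have "(z - w) *\<^sub>C R z b = R z (y - (T b - z *\<^sub>C b))"
    using assms b by (simp add: R_scaleC)
  also have "\<dots> = R z y - b" using assms b R_diff[of z y "T b - z *\<^sub>C b"] R_left[of z b] by simp
  finally show ?thesis by (simp add: b_def)
qed

text \<open>A lower bound \<open>c\<close> at \<open>w\<close> leaves \<open>c / 2\<close> on the
  disc of radius \<open>c / 2\<close>, so there the resolvents are bounded by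
  \<open>2 / c\<close>.\<close>

lemma locally_bounded:
  assumes "w \<in> B"
  obtains C where "eventually (\<lambda>z. z \<in> B \<and> (\<forall>y\<in>H. norm (R z y) \<le> C * norm y)) (nhds w)"
proof -
  have "w \<notin> spectrum_on H T" using assms spectrum_B by blast
  then obtain c where c: "c > 0" "\<And>x. x \<in> H \<Longrightarrow> c * norm x \<le> norm (T x - w *\<^sub>C x)"
    using bounded_below_if_notin_spectrum by metis
  have "eventually (\<lambda>z. z \<in> B \<inter> ball w (c / 2)) (nhds w)"
    using assms c open_B by (intro eventually_nhds_in_open) auto
  then have "eventually (\<lambda>z. z \<in> B \<and> (\<forall>y\<in>H. norm (R z y) \<le> (2 / c) * norm y)) (nhds w)"
  proof (rule eventually_mono, intro conjI ballI)
    fix z y assume z: "z \<in> B \<inter> ball w (c / 2)" and y: "y \<in> H"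
    have "(c / 2) * norm (R z y) \<le> (c - cmod (z - w)) * norm (R z y)"
      using z by (intro mult_right_mono) (auto simp: dist_norm norm_minus_commute)
    also have "\<dots> \<le> norm (T (R z y) - z *\<^sub>C R z y)"
      using bounded_below_perturb[OF c(2)[of "R z y"]] y by simp
    also have "\<dots> = norm y" using R_right[of z y] z y by simp
    finally show "norm (R z y) \<le> (2 / c) * norm y" using c by (simp add: field_simps)
  qed auto
  then show thesis by (rule that)
qed

text \<open>Argument and parameter vary together because the induction for powers applies
  \<open>R z\<close> to a difference quotient that itself depends on \<open>z\<close>.\<close>

lemma tendsto_R:
  assumes w: "w \<in> B" and a: "(a \<longlongrightarrow> a0) (at w)" and aH: "\<And>z. a z \<in> H" "a0 \<in> H"
  shows "((\<lambda>z. R z (a z)) \<longlongrightarrow> R w a0) (at w)"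
proof -
  define b where "b = R w a0"
  have b: "b \<in> H" "T b - w *\<^sub>C b = a0" using w aH R_right[of w a0] by (simp_all add: b_def)
  obtain C where C: "eventually (\<lambda>z. z \<in> B \<and> (\<forall>y\<in>H. norm (R z y) \<le> C * norm y)) (nhds w)"
    using locally_bounded[OF w] .
  \<comment> \<open>\<open>R z\<close> maps this vector to \<open>R z (a z) - b\<close>; since the
    vector tends to zero, the local bound on \<open>R z\<close> suffices.\<close>
  have "((\<lambda>z. a z - (T b - z *\<^sub>C b)) \<longlongrightarrow> a0 - (T b - w *\<^sub>C b)) (at w)"
    by (intro tendsto_diff a tendsto_const scaleC.tendsto tendsto_ident_at)
  then have "((\<lambda>z. C * norm (a z - (T b - z *\<^sub>C b))) \<longlongrightarrow> C * norm (a0 - (T b - w *\<^sub>C b))) (at w)"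
    by (intro tendsto_mult tendsto_const tendsto_norm)
  then have lim: "((\<lambda>z. C * norm (a z - (T b - z *\<^sub>C b))) \<longlongrightarrow> 0) (at w)" by (simp add: b)
  have "eventually (\<lambda>z. norm (R z (a z) - b) \<le> C * norm (a z - (T b - z *\<^sub>C b))) (at w)"
    using eventually_nhds_conv_at[THEN iffD1, OF C, THEN conjunct1]
  proof eventually_elim
    case (elim z)
    have "R z (a z) - b = R z (a z - (T b - z *\<^sub>C b))"
      using elim b aH R_left[of z b] by (simp add: R_diff)
    then show ?case using elim aH b by auto
  qed
  then have "((\<lambda>z. R z (a z) - b) \<longlongrightarrow> 0) (at w)" by (rule Lim_null_comparison[OF _ lim])
  then show ?thesis unfolding b_def by (rule LIM_zero_cancel)
qed

lemma R_funpow_mem [simp, intro]: "u \<in> H \<Longrightarrow> (R z ^^ n) u \<in> H"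
  by (induction n) auto

text \<open>Product rule: the change of \<open>R z ^^ Suc n\<close> splits into the change of the
  inner power, handled by induction, and that of the outer resolvent, handled by the resolvent
  identity.\<close>

lemma difference_quotient_R_funpow:
  assumes w: "w \<in> B" and u: "u \<in> H"
  shows "((\<lambda>z. (1 / (z - w)) *\<^sub>C ((R z ^^ n) u - (R w ^^ n) u)) \<longlongrightarrow>
    of_nat n *\<^sub>C (R w ^^ Suc n) u) (at w)"
proof (induction n)
  case 0
  show ?case by (simp add: scaleC.zero_left scaleC.zero_right)
next
  case (Suc n)
  let ?a = "\<lambda>z. (R z ^^ n) u"
  let ?q = "\<lambda>z. (1 / (z - w)) *\<^sub>C (?a z - ?a w)"
  have "((\<lambda>z. R z (?q z) + R z (R w (?a w))) \<longlongrightarrow>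
      R w (of_nat n *\<^sub>C (R w ^^ Suc n) u) + R w (R w (?a w))) (at w)"
    using w u by (intro tendsto_add tendsto_R tendsto_const Suc.IH) auto
  also have "R w (of_nat n *\<^sub>C (R w ^^ Suc n) u) + R w (R w (?a w)) = of_nat (Suc n) *\<^sub>C (R w ^^ Suc (Suc n)) u"
    using w u by (simp add: R_scaleC scaleC_add_left scaleC_one add.commute)
  finally have lim: "((\<lambda>z. R z (?q z) + R z (R w (?a w))) \<longlongrightarrow>
      of_nat (Suc n) *\<^sub>C (R w ^^ Suc (Suc n)) u) (at w)" .
  have "eventually (\<lambda>z. z \<in> B) (nhds w)" using open_B w by (rule eventually_nhds_in_open)
  then have "eventually (\<lambda>z. z \<in> B - {w}) (at w)"
    unfolding eventually_at_filter by eventually_elim auto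
  then have "eventually (\<lambda>z. R z (?q z) + R z (R w (?a w)) =
      (1 / (z - w)) *\<^sub>C ((R z ^^ Suc n) u - (R w ^^ Suc n) u)) (at w)"
  proof eventually_elim
    case (elim z)
    have "(R z ^^ Suc n) u - (R w ^^ Suc n) u = R z (?a z - ?a w) + (R z (?a w) - R w (?a w))"
      using elim u by (simp add: R_diff)
    also have "\<dots> = R z (?a z - ?a w) + (z - w) *\<^sub>C R z (R w (?a w))"
      using elim u w resolvent_identity[of z w "?a w"] by simp
    finally show ?case using elim u
      by (simp add: R_scaleC scaleC_add_right scaleC_scaleC scaleC_one)
  qed
  then show ?case using lim by (rule tendsto_cong[THEN iffD1])
qed

lemma has_field_derivative_R_funpow:
  assumes "w \<in> B" "u \<in> H"
  shows "((\<lambda>z. cinner ((R z ^^ n) u) y) has_field_derivative of_nat n * cinner ((R w ^^ Suc n) u) y) (at w)"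
  using cinner.tendsto[OF difference_quotient_R_funpow[OF assms, of n] tendsto_const[of y]]
  unfolding has_field_derivative_iff
  by (simp add: cinner_scaleC_left cinner.diff_left)

lemma higher_deriv_R:
  assumes u: "u \<in> H"
  shows "z \<in> B \<Longrightarrow> (deriv ^^ n) (\<lambda>z. cinner (R z u) y) z = fact n * cinner ((R z ^^ Suc n) u) y"
proof (induction n arbitrary: z)
  case (Suc n)
  have "eventually (\<lambda>z. z \<in> B) (nhds z)" using Suc.prems open_B by (rule eventually_nhds_in_open[rotated])
  then have "eventually (\<lambda>z. (deriv ^^ n) (\<lambda>z. cinner (R z u) y) z = fact n * cinner ((R z ^^ Suc n) u) y) (nhds z)"
    by eventually_elim (rule Suc.IH)
  then have "deriv ((deriv ^^ n) (\<lambda>z. cinner (R z u) y)) z = deriv (\<lambda>z. fact n * cinner ((R z ^^ Suc n) u) y) z"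
    by (rule deriv_cong_ev) simp
  also have "\<dots> = fact n * (of_nat (Suc n) * cinner ((R z ^^ Suc (Suc n)) u) y)"
    using Suc.prems u by (intro DERIV_imp_deriv DERIV_cmult has_field_derivative_R_funpow)
  finally show ?case by (simp add: mult.assoc mult.left_commute)
qed simp

text \<open>Cauchy's estimate for the scalar function \<open>cinner (R z u) y\<close>. The constant
  \<open>C\<close> bounds \<open>norm (R z u)\<close> on the closed disc, so it does not depend on
  \<open>n\<close>.\<close>

lemma norm_R_funpow_le:
  assumes r: "r > 0" "cball \<mu> r \<subseteq> B" and u: "u \<in> H"
  obtains C where "\<And>n. norm ((R \<mu> ^^ Suc n) u) * r ^ n \<le> C"
proof -
  have \<mu>: "\<mu> \<in> B" by (rule subsetD[OF r(2)]) (use r(1) in simp)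
  have cont: "continuous_on (cball \<mu> r) (\<lambda>z. R z u)"
    unfolding continuous_on_def
    using r u tendsto_R[OF _ tendsto_const, of _ u] by (blast intro: tendsto_within_subset)
  have "bounded ((\<lambda>z. R z u) ` cball \<mu> r)"
    by (intro compact_imp_bounded compact_continuous_image cont compact_cball)
  then obtain C where C: "\<And>z. z \<in> cball \<mu> r \<Longrightarrow> norm (R z u) \<le> C"
    unfolding bounded_iff by blast
  have "norm ((R \<mu> ^^ Suc n) u) * r ^ n \<le> C" for n
  proof -
    \<comment> \<open>For this \<open>y\<close> the derivative at \<open>\<mu>\<close> is
      \<open>fact n\<close> times the square of \<open>norm y\<close>, so one factor
      \<open>norm y\<close> cancels and a norm estimate remains.\<close>
    define y where "y = (R \<mu> ^^ Suc n) u"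
    have "norm ((deriv ^^ n) (\<lambda>z. cinner (R z u) y) \<mu>) \<le> fact n * (C * norm y) / r ^ n"
    proof (rule Cauchy_inequality)
      show "(\<lambda>z. cinner (R z u) y) holomorphic_on ball \<mu> r"
      proof (rule holomorphic_onI)
        fix w assume "w \<in> ball \<mu> r"
        then have "w \<in> B" using r by auto
        from has_field_derivative_R_funpow[OF this u, of 1 y]
        show "(\<lambda>z. cinner (R z u) y) field_differentiable at w within ball \<mu> r"
          unfolding field_differentiable_def by simp (blast intro: has_field_derivative_at_within)
      qed
      show "continuous_on (cball \<mu> r) (\<lambda>z. cinner (R z u) y)"
        by (intro cinner.continuous_on cont continuous_on_const)
      show "cmod (cinner (R x u) y) \<le> C * norm y" if "cmod (\<mu> - x) = r" for x
        using that by (intro order_trans[OF cmod_cinner_le mult_right_mono[OF C norm_ge_zero]])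
          (simp add: dist_norm)
    qed (use r in auto)
    also have "(deriv ^^ n) (\<lambda>z. cinner (R z u) y) \<mu> = fact n * complex_of_real ((norm y)\<^sup>2)"
      using higher_deriv_R[OF u \<mu>, of n y] unfolding y_def[symmetric] cinner_self .
    finally have "fact n * (norm y * r ^ n) * norm y \<le> fact n * C * norm y"
      using r by (simp add: norm_mult pos_le_divide_eq power2_eq_square mult_ac)
    then have "norm y * r ^ n * norm y \<le> C * norm y" by (simp add: mult.assoc)
    moreover have "0 \<le> C" using order_trans[OF norm_ge_zero C[of \<mu>]] r by simp
    ultimately show ?thesis unfolding y_def[symmetric]
      by (cases "norm y = 0") (auto simp: mult.commute)
  qed
  then show thesis by (rule that)
qed

text \<open>For \<open>u = T x - \<mu> *\<^sub>C x\<close> the sequence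
  \<open>norm ((R \<mu> ^^ n) u) * r ^ n\<close> is log-convex and bounded, so its first step does
  not increase; that step is the claim.\<close>

lemma bounded_below_if_cball_disjoint:
  assumes r: "r > 0" "cball \<mu> r \<subseteq> B" and x: "x \<in> H"
  shows "r * norm x \<le> norm (T x - \<mu> *\<^sub>C x)"
proof -
  interpret M: normal_operator H "\<lambda>x. T x - \<mu> *\<^sub>C x" "\<lambda>x. S x - cnj \<mu> *\<^sub>C x"
    by (rule shift)
  have \<mu>: "\<mu> \<in> B" by (rule subsetD[OF r(2)]) (use r(1) in simp)
  define u where "u = T x - \<mu> *\<^sub>C x"
  have u: "u \<in> H" "R \<mu> u = x" using x R_left[OF \<mu>] by (simp_all add: u_def)
  obtain C where C: "\<And>n. norm ((R \<mu> ^^ Suc n) u) * r ^ n \<le> C"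
    using norm_R_funpow_le[OF r u(1)] by blast
  define a where "a n = norm ((R \<mu> ^^ n) u) * r ^ n" for n
  have "a 1 \<le> a 0"
  proof (rule log_convex_le_one)
    show "0 \<le> a n" for n using r by (simp add: a_def)
    show "(a (Suc n))\<^sup>2 \<le> a n * a (Suc (Suc n))" for n
    proof -
      define v where "v = (R \<mu> ^^ n) u"
      have v: "v \<in> H" using u by (simp add: v_def)
      have "(norm (R \<mu> v))\<^sup>2 \<le> norm v * norm (R \<mu> (R \<mu> v))"
        \<comment> \<open>Log-convexity for \<open>T - \<mu>\<close> at this vector, where each
          application removes one resolvent.\<close>
        using M.norm_T_squared_le[of "R \<mu> (R \<mu> v)"] R_right[OF \<mu>] v by simp
      then have "(norm (R \<mu> v))\<^sup>2 * (r ^ Suc n)\<^sup>2 \<le> norm v * norm (R \<mu> (R \<mu> v)) * (r ^ Suc n)\<^sup>2"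
        by (intro mult_right_mono) auto
      then show ?thesis
        by (simp add: a_def v_def power_mult_distrib power2_eq_square mult_ac)
    qed
    \<comment> \<open>The Cauchy bound covers \<open>n \<ge> 1\<close> only and has one factor
      \<open>r\<close> less than \<open>a n\<close>.\<close>
    show "a n \<le> max (a 0) (C * r)" for n
    proof (cases n)
      case (Suc m)
      then show ?thesis using mult_right_mono[OF C[of m], of r] r
        by (simp add: a_def le_max_iff_disj mult_ac)
    qed simp
  qed
  then show ?thesis by (simp add: a_def u u_def[symmetric] mult.commute)
qed

end

context normal_operator
begin

lemma bounded_below_by_distance:
  assumes disj: "ball \<mu> r \<inter> spectrum_on H T = {}" and x: "x \<in> H"
  shows "r * norm x \<le> norm (T x - \<mu> *\<^sub>C x)"
proof (rule dense_le)
  have "\<exists>R. (\<forall>y\<in>H. R y \<in> H) \<and> (z \<in> ball \<mu> r \<longrightarrow>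
      (\<forall>y\<in>H. R (T y - z *\<^sub>C y) = y \<and> T (R y) - z *\<^sub>C R y = y))" for z
  proof (cases "z \<in> ball \<mu> r")
    case True
    then have "z \<notin> spectrum_on H T" using disj by blast
    then show ?thesis unfolding spectrum_on_def bounded_op_on_def linear_op_on_def by blast
  next
    case False
    then show ?thesis by (intro exI[of _ id]) auto
  qed
  then obtain R where "\<And>z. (\<forall>y\<in>H. R z y \<in> H) \<and> (z \<in> ball \<mu> r \<longrightarrow>
      (\<forall>y\<in>H. R z (T y - z *\<^sub>C y) = y \<and> T (R z y) - z *\<^sub>C R z y = y))"
    by metis
  then interpret resolvent_family H T S "ball \<mu> r" R
    using disj by unfold_locales auto
  \<comment> \<open>Only the open disc is known to miss the spectrum, so the bound is proved for
    closed discs of radius \<open>s < r\<close> and passes to the supremum.\<close>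
  fix t assume t: "t < r * norm x"
  show "t \<le> norm (T x - \<mu> *\<^sub>C x)"
  proof (cases "t \<le> 0")
    case False
    then have nz: "norm x > 0" using t by (cases "x = 0") auto
    define s where "s = t / norm x"
    have "0 < s" "s < r" using False t nz by (simp_all add: s_def pos_divide_less_eq)
    then have "cball \<mu> s \<subseteq> ball \<mu> r" by auto
    then show ?thesis
      using bounded_below_if_cball_disjoint[of s \<mu> x] \<open>0 < s\<close> x nz by (simp add: s_def)
  qed (meson norm_ge_zero order_trans)
qed

text \<open>An empty spectrum would admit every radius in \<open>bounded_below_by_distance\<close>;
  this replaces the usual Liouville argument.\<close>

lemma spectrum_nonempty:
  assumes "x \<in> H" "x \<noteq> 0"
  shows "spectrum_on H T \<noteq> {}"
proof
  assume "spectrum_on H T = {}"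
  then have "t * norm x \<le> norm (T x)" for t
    using bounded_below_by_distance[of 0 t x] assms by (simp add: scaleC.zero_left)
  from this[of "(norm (T x) + 1) / norm x"] show False using assms by simp
qed

end

section \<open>Isolated points of the spectrum\<close>

text \<open>\<open>q\<close> is abstract because it is used both for
  \<open>(norm (T u - \<mu> *\<^sub>C u))\<^sup>2 / r\<close> and for
  \<open>\<delta> * (norm u)\<^sup>2\<close>. The left side is linear in the length of
  \<open>y\<close> and \<open>q y\<close> quadratic in these uses, so \<open>y\<close> can be
  rescaled to optimize the bound.\<close>

lemma cinner_polarization_bound:
  fixes A :: "'a::complex_hilbert_space \<Rightarrow> 'a" and q :: "'a \<Rightarrow> real"
  assumes V: "csubspace V"
    and add: "\<And>x y. x \<in> V \<Longrightarrow> y \<in> V \<Longrightarrow> A (x + y) = A x + A y"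
    and scale: "\<And>c x. x \<in> V \<Longrightarrow> A (c *\<^sub>C x) = c *\<^sub>C A x"
    and bound: "\<And>x. x \<in> V \<Longrightarrow> cmod (cinner (A x) x) \<le> q x"
    and parallelogram: "\<And>x y. x \<in> V \<Longrightarrow> y \<in> V \<Longrightarrow> q (x + y) + q (x - y) = 2 * q x + 2 * q y"
    and rotate: "\<And>x. x \<in> V \<Longrightarrow> q (\<i> *\<^sub>C x) = q x"
    and x: "x \<in> V" and y: "y \<in> V"
  shows "cmod (cinner (A x) y) \<le> q x + q y"
proof -
  define F where "F u = cinner (A u) u" for u
  have iy: "\<i> *\<^sub>C y \<in> V" using V y by (rule complex_vector.subspace_scale)
  have plus: "F (u + v) = F u + F v + (cinner (A u) v + cinner (A v) u)"
    if "u \<in> V" "v \<in> V" for u v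
    using that by (simp add: F_def add cinner_simps)
  have minus: "F (u - v) = F u + F v - (cinner (A u) v + cinner (A v) u)"
    if "u \<in> V" "v \<in> V" for u v
  proof -
    have "A (u - v) = A u - A v"
      using add[of "u - v" v] that V by (simp add: complex_vector.subspace_diff)
    then show ?thesis by (simp add: F_def cinner_simps)
  qed
  \<comment> \<open>Polarization identity; the parallelogram law for \<open>q\<close> then sums the
    four bounds to \<open>4 * (q x + q y)\<close>.\<close>
  have "4 * cinner (A x) y = F (x + y) - F (x - y) + \<i> * F (x + \<i> *\<^sub>C y) - \<i> * F (x - \<i> *\<^sub>C y)"
    unfolding plus[OF x y] minus[OF x y] plus[OF x iy] minus[OF x iy]
    using y by (simp add: scale cinner_simps algebra_simps)
  then have "cmod (4 * cinner (A x) y) \<le>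
      cmod (F (x + y)) + cmod (F (x - y)) + cmod (F (x + \<i> *\<^sub>C y)) + cmod (F (x - \<i> *\<^sub>C y))"
    using norm_triangle_ineq4[of "F (x + y) - F (x - y) + \<i> * F (x + \<i> *\<^sub>C y)" "\<i> * F (x - \<i> *\<^sub>C y)"]
      norm_triangle_ineq[of "F (x + y) - F (x - y)" "\<i> * F (x + \<i> *\<^sub>C y)"]
      norm_triangle_ineq4[of "F (x + y)" "F (x - y)"]
    by (simp add: norm_mult)
  also have "\<dots> \<le> q (x + y) + q (x - y) + q (x + \<i> *\<^sub>C y) + q (x - \<i> *\<^sub>C y)"
    unfolding F_def using x y iy V
    by (intro add_mono bound) (auto intro: complex_vector.subspace_add complex_vector.subspace_diff)
  also have "\<dots> = 4 * (q x + q y)"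
    using parallelogram[OF x y] parallelogram[OF x iy] rotate[OF y] by simp
  finally show ?thesis by (simp add: norm_mult)
qed

lemma csubspace_closure:
  fixes W :: "'a::complex_hilbert_space set"
  assumes "csubspace W"
  shows "csubspace (closure W)"
proof (rule complex_vector.subspaceI)
  show "0 \<in> closure W"
    using complex_vector.subspace_0[OF assms] closure_subset by blast
next
  fix l l' assume "l \<in> closure W" "l' \<in> closure W"
  then obtain x x' where "\<forall>n. x n \<in> W" "x \<longlonglongrightarrow> l" "\<forall>n. x' n \<in> W" "x' \<longlonglongrightarrow> l'"
    unfolding closure_sequential by blast
  then have "\<forall>n. x n + x' n \<in> W" "(\<lambda>n. x n + x' n) \<longlonglongrightarrow> l + l'"
    using complex_vector.subspace_add[OF assms] tendsto_add by blast+
  then show "l + l' \<in> closure W"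
    unfolding closure_sequential by (intro exI[of _ "\<lambda>n. x n + x' n"] conjI)
next
  fix c l assume "l \<in> closure W"
  then obtain x where "\<forall>n. x n \<in> W" "x \<longlonglongrightarrow> l"
    unfolding closure_sequential by blast
  then have "\<forall>n. c *\<^sub>C x n \<in> W" "(\<lambda>n. c *\<^sub>C x n) \<longlonglongrightarrow> c *\<^sub>C l"
    using complex_vector.subspace_scale[OF assms] scaleC.tendsto[OF tendsto_const] by blast+
  then show "c *\<^sub>C l \<in> closure W"
    unfolding closure_sequential by (intro exI[of _ "\<lambda>n. c *\<^sub>C x n"] conjI)
qed

text \<open>The vectors lie in the unit ball because quantifiers range over it. One tolerance serves
  the eigenvector equation and the Gram matrix, since a single sentence measures both.\<close>

definition almost_eigenvectors ::
  "nat \<Rightarrow> complex \<Rightarrow> 'a::complex_hilbert_space set \<Rightarrow> ('a \<Rightarrow> 'a) \<Rightarrow> real \<Rightarrow> (nat \<Rightarrow> 'a) \<Rightarrow> bool" where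
  "almost_eigenvectors n \<mu> H T \<eta> x \<longleftrightarrow>
     (\<forall>j<n. x j \<in> H \<inter> cball 0 1 \<and> norm (T (x j) - \<mu> *\<^sub>C x j) \<le> \<eta> \<and>
        (\<forall>i<n. cmod (cinner (x i) (x j) - of_bool (i = j)) \<le> \<eta>))"

text \<open>As the two parts are orthogonal, the Gram matrices of \<open>x\<close> and
  \<open>y\<close> differ by that of \<open>z\<close>, an error of at most
  \<open>\<epsilon>\<^sup>2\<close>. \<open>V\<close> will be the eigenspace in the limit and the
  range of a spectral projection in the models.\<close>

lemma almost_orthonormal_split_cdim_ge:
  fixes V :: "'a::complex_hilbert_space set" and x y z :: "nat \<Rightarrow> 'a"
  assumes V: "csubspace V" and x: "\<And>j. j < n \<Longrightarrow> x j = y j + z j"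
    and y: "\<And>j. j < n \<Longrightarrow> y j \<in> V" and z: "\<And>j. j < n \<Longrightarrow> norm (z j) \<le> \<epsilon>"
    and orth: "\<And>i j. i < n \<Longrightarrow> j < n \<Longrightarrow> cinner (z i) (y j) = 0"
    and \<eta>: "\<And>i j. i < n \<Longrightarrow> j < n \<Longrightarrow> cmod (cinner (x i) (x j) - of_bool (i = j)) \<le> \<eta>"
    and n\<eta>: "real n * (\<eta> + \<epsilon>\<^sup>2) < 1"
  shows "enat n \<le> cdim V"
proof (rule almost_orthonormal_cdim_ge[OF V y _ n\<eta>])
  fix i j assume i: "i < n" and j: "j < n"
  have "cinner (y i) (z j) = 0" using orth[OF j i] cinner_zero_commute by blast
  then have "cinner (y i) (y j) - of_bool (i = j) = (cinner (x i) (x j) - of_bool (i = j)) - cinner (z i) (z j)"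
    using orth[OF i j] by (simp add: x i j cinner_simps)
  also have "cmod \<dots> \<le> cmod (cinner (x i) (x j) - of_bool (i = j)) + cmod (cinner (z i) (z j))"
    by (rule norm_triangle_ineq4)
  also have "cmod (cinner (z i) (z j)) \<le> norm (z i) * norm (z j)" by (rule cmod_cinner_le)
  also have "\<dots> \<le> \<epsilon> * \<epsilon>"
    using z[OF i] z[OF j] by (intro mult_mono) (auto intro: order_trans[OF norm_ge_zero])
  finally show "cmod (cinner (y i) (y j) - of_bool (i = j)) \<le> \<eta> + \<epsilon>\<^sup>2"
    using \<eta>[OF i j] by (simp add: power2_eq_square)
qed

context normal_operator
begin

lemma csubspace_eigenspace: "csubspace (eigenspace_on H T \<mu>)"
  unfolding complex_vector.subspace_def eigenspace_on_def
  by (auto simp: T_add T_scaleC scaleC_add_right scaleC_scaleC scaleC.zero_right mult.commute)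

text \<open>With \<open>M = T - \<mu>\<close>, expand \<open>\<parallel>Mx - wx\<parallel>\<^sup>2 \<ge> \<bar>w\<bar>\<^sup>2 \<parallel>x\<parallel>\<^sup>2\<close> for \<open>\<bar>w\<bar> = r/2\<close>: this holds because \<open>\<mu> + w\<close> has
  distance at least \<open>r/2\<close> from the spectrum, and the terms \<open>\<bar>w\<bar>\<^sup>2 \<parallel>x\<parallel>\<^sup>2\<close> cancel.\<close>

lemma isolated_numerical_bound:
  assumes r: "r > 0" and gap: "spectrum_on H T \<inter> ball \<mu> r \<subseteq> {\<mu>}" and x: "x \<in> H"
  shows "r * cmod (cinner (T x - \<mu> *\<^sub>C x) x) \<le> (norm (T x - \<mu> *\<^sub>C x))\<^sup>2"
proof -
  define y where "y = T x - \<mu> *\<^sub>C x"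
  define a where "a = cinner y x"
  \<comment> \<open>\<open>w\<close> has the phase of \<open>a\<close>, which makes the cross term
    \<open>cnj w * a\<close> equal to its modulus.\<close>
  define w where "w = complex_of_real (r / 2) * sgn a"
  show ?thesis
  proof (cases "a = 0")
    case False
    then have w: "cmod w = r / 2" using r by (simp add: w_def norm_mult norm_sgn)
    have "ball (\<mu> + w) (r / 2) \<inter> spectrum_on H T = {}"
    proof (rule ccontr)
      assume "ball (\<mu> + w) (r / 2) \<inter> spectrum_on H T \<noteq> {}"
      then obtain z where z: "dist (\<mu> + w) z < r / 2" "z \<in> spectrum_on H T" by auto
      have "dist \<mu> (\<mu> + w) = r / 2" using w by (simp add: dist_norm)
      then have "z \<in> ball \<mu> r" using dist_triangle[of \<mu> z "\<mu> + w"] z(1) by simp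
      then have "z = \<mu>" using gap z(2) by blast
      then show False using z(1) w by (simp add: dist_norm)
    qed
    then have "(r / 2) * norm x \<le> norm (T x - (\<mu> + w) *\<^sub>C x)"
      using x by (rule bounded_below_by_distance)
    also have "T x - (\<mu> + w) *\<^sub>C x = y - w *\<^sub>C x" by (simp add: y_def scaleC_add_left)
    finally have "((r / 2) * norm x)\<^sup>2 \<le> (norm (y - w *\<^sub>C x))\<^sup>2"
      using r by (intro power_mono) auto
    also have "\<dots> = (norm y)\<^sup>2 - 2 * Re (cinner y (w *\<^sub>C x)) + (norm (w *\<^sub>C x))\<^sup>2"
      unfolding power2_norm_eq_inner inner_diff_left inner_diff_right
      by (simp add: inner_commute inner_eq_Re_cinner[symmetric])
    also have "norm (w *\<^sub>C x) = (r / 2) * norm x" by (simp add: norm_scaleC w)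
    also have "Re (cinner y (w *\<^sub>C x)) = (r / 2) * cmod a"
    proof -
      have "cnj (sgn a) * a = complex_of_real (cmod a)"
        using False complex_norm_square[of a]
        by (simp add: sgn_div_norm scaleR_conv_of_real field_simps power2_eq_square)
      then have "cinner y (w *\<^sub>C x) = complex_of_real ((r / 2) * cmod a)"
        by (simp add: w_def cinner_scaleC_right a_def[symmetric] mult.assoc)
      then show ?thesis by (simp only: Re_complex_of_real)
    qed
    finally show ?thesis by (simp add: a_def y_def)
  qed (simp add: a_def y_def)
qed

text \<open>Polarizing the previous bound gives \<open>r \<bar>\<langle>Mx, z\<rangle>\<bar> \<le> \<parallel>Mx\<parallel>\<^sup>2 + \<parallel>Mz\<parallel>\<^sup>2\<close>; take \<open>z = (2/r) Mx\<close>. So \<open>M\<close> is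
  bounded below on its range, which is dense in the orthogonal complement of the eigenspace.\<close>

lemma isolated_bounded_below_range:
  assumes r: "r > 0" and gap: "spectrum_on H T \<inter> ball \<mu> r \<subseteq> {\<mu>}" and x: "x \<in> H"
  defines "y \<equiv> T x - \<mu> *\<^sub>C x"
  shows "norm y \<le> (2 / r) * norm (T y - \<mu> *\<^sub>C y)"
proof -
  interpret M: normal_operator H "\<lambda>x. T x - \<mu> *\<^sub>C x" "\<lambda>x. S x - cnj \<mu> *\<^sub>C x"
    by (rule shift)
  define q where "q u = (norm (T u - \<mu> *\<^sub>C u))\<^sup>2 / r" for u
  have yH: "y \<in> H" unfolding y_def using x by auto
  have "cmod (cinner (T x - \<mu> *\<^sub>C x) ((2 / r) *\<^sub>R y)) \<le> q x + q ((2 / r) *\<^sub>R y)"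
  proof (rule cinner_polarization_bound[OF csubspace])
    show "cmod (cinner (T u - \<mu> *\<^sub>C u) u) \<le> q u" if "u \<in> H" for u
      using isolated_numerical_bound[OF r gap that] r by (simp add: q_def field_simps)
    show "q (u + v) + q (u - v) = 2 * q u + 2 * q v" if "u \<in> H" "v \<in> H" for u v
      using parallelogram_law[of "T u - \<mu> *\<^sub>C u" "T v - \<mu> *\<^sub>C v"]
        M.T_add[OF that] M.T_diff[OF that] by (simp add: q_def add_divide_distrib[symmetric])
    show "q (\<i> *\<^sub>C u) = q u" if "u \<in> H" for u
      using M.T_scaleC[OF that, of \<i>] by (simp add: q_def norm_scaleC)
  qed (use M.T_add M.T_scaleC x yH in auto)
  moreover have "cmod (cinner (T x - \<mu> *\<^sub>C x) ((2 / r) *\<^sub>R y)) = (2 / r) * (norm y)\<^sup>2"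
    using r unfolding y_def[symmetric] cinner_scaleR_right cinner_self by (simp add: norm_power)
  moreover have "q x = (norm y)\<^sup>2 / r" by (simp add: q_def y_def)
  moreover have "q ((2 / r) *\<^sub>R y) = (2 / r)\<^sup>2 * (norm (T y - \<mu> *\<^sub>C y))\<^sup>2 / r"
    unfolding q_def M.T_scaleR[OF yH] norm_scaleR power_mult_distrib by (simp add: power_divide)
  ultimately have "(2 / r) * (norm y)\<^sup>2 \<le> ((norm y)\<^sup>2 + (2 / r)\<^sup>2 * (norm (T y - \<mu> *\<^sub>C y))\<^sup>2) / r"
    by (simp add: add_divide_distrib)
  then have "2 * (norm y)\<^sup>2 \<le> (norm y)\<^sup>2 + (2 / r)\<^sup>2 * (norm (T y - \<mu> *\<^sub>C y))\<^sup>2"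
    using r by (simp add: pos_le_divide_eq)
  then have "(norm y)\<^sup>2 \<le> ((2 / r) * norm (T y - \<mu> *\<^sub>C y))\<^sup>2"
    by (simp only: power_mult_distrib)
  then show ?thesis by (rule power2_le_imp_le) (use r in simp)
qed

text \<open>The projection \<open>v\<close> of \<open>x\<close> is taken onto the closure of the
  range of \<open>T - \<mu>\<close>, because the lower bound is known on the range and extends to
  \<open>v\<close> by continuity. The rest \<open>p = x - v\<close> is orthogonal to the range,
  hence an eigenvector, so \<open>T - \<mu>\<close> takes the same value at \<open>v\<close> and at
  \<open>x\<close>.\<close>

lemma isolated_eigenvector_near:
  assumes r: "r > 0" and gap: "spectrum_on H T \<inter> ball \<mu> r \<subseteq> {\<mu>}" and x: "x \<in> H"
  obtains p where "p \<in> eigenspace_on H T \<mu>" "norm (x - p) \<le> (2 / r) * norm (T x - \<mu> *\<^sub>C x)"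
    "\<And>w. w \<in> eigenspace_on H T \<mu> \<Longrightarrow> cinner (x - p) w = 0"
proof -
  let ?M = "\<lambda>x. T x - \<mu> *\<^sub>C x"
  interpret M: normal_operator H ?M "\<lambda>x. S x - cnj \<mu> *\<^sub>C x"
    by (rule shift)
  obtain v where v: "v \<in> closure (?M ` H)" "\<And>w. w \<in> closure (?M ` H) \<Longrightarrow> cinner (x - v) w = 0"
    using ex_orthogonal_projection[OF csubspace_closure[OF M.csubspace_range] closed_closure] by blast
  have "closure (?M ` H) \<subseteq> H" using closed by (intro closure_minimal) auto
  then have vH: "v \<in> H" using v(1) by blast
  obtain f where f: "\<And>n. f n \<in> ?M ` H" "f \<longlonglongrightarrow> v" using v(1) unfolding closure_sequential by blast
  have fH: "f n \<in> H" for n using f(1)[of n] by auto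
  have "(\<lambda>n. ?M (f n)) \<longlonglongrightarrow> ?M v"
    using M.continuous_on_T f(2) fH vH by (auto simp: continuous_on_sequentially comp_def)
  then have "(\<lambda>n. (2 / r) * norm (?M (f n))) \<longlonglongrightarrow> (2 / r) * norm (?M v)"
    by (intro tendsto_mult tendsto_const tendsto_norm)
  moreover have "norm (f n) \<le> (2 / r) * norm (?M (f n))" for n
  proof -
    obtain u where "u \<in> H" "f n = ?M u" using f(1)[of n] by blast
    then show ?thesis using isolated_bounded_below_range[OF r gap, of u] by simp
  qed
  ultimately have v_le: "norm v \<le> (2 / r) * norm (?M v)"
    using LIMSEQ_le[OF tendsto_norm[OF f(2)]] by blast
  have orth: "cinner v w = 0" if w: "w \<in> eigenspace_on H T \<mu>" for w
  proof -
    have w': "w \<in> H" "?M w = 0" using w by (auto simp: eigenspace_on_def)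
    \<comment> \<open>By normality an eigenvector is killed by the adjoint as well, hence it is
      orthogonal to the range.\<close>
    then have "S w - cnj \<mu> *\<^sub>C w = 0" using M.norm_adjoint[of w] by simp
    then have "cinner (f n) w = 0" for n
      using f(1)[of n] M.cinner_T[of _ w] w'(1) by (auto simp: cinner.zero_right)
    then have "(\<lambda>n. cinner (f n) w) \<longlonglongrightarrow> 0" by simp
    moreover have "(\<lambda>n. cinner (f n) w) \<longlonglongrightarrow> cinner v w"
      by (intro cinner.tendsto f tendsto_const)
    ultimately show ?thesis using LIMSEQ_unique by blast
  qed
  have Mp: "?M (x - v) = 0"
  proof (rule M.orthogonal_range)
    fix u assume "u \<in> H"
    then have "?M u \<in> closure (?M ` H)" by (intro subsetD[OF closure_subset] imageI)
    then show "cinner (x - v) (?M u) = 0" by (rule v(2))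
  qed (rule mem_H(3)[OF x vH])
  then have "?M x = ?M v" using M.T_diff[OF x vH] by simp
  then show thesis
    using that[of "x - v"] Mp v_le orth x vH by (auto simp: eigenspace_on_def)
qed

lemma cdim_eigenspace_ge:
  assumes r: "r > 0" and gap: "spectrum_on H T \<inter> ball \<mu> r \<subseteq> {\<mu>}"
    and x: "almost_eigenvectors n \<mu> H T \<eta> x" and \<eta>: "real n * (\<eta> + (2 / r * \<eta>)\<^sup>2) < 1"
  shows "enat n \<le> cdim (eigenspace_on H T \<mu>)"
proof -
  have "\<forall>j\<in>{..<n}. \<exists>p. p \<in> eigenspace_on H T \<mu> \<and> norm (x j - p) \<le> 2 / r * norm (T (x j) - \<mu> *\<^sub>C x j) \<and>
      (\<forall>w\<in>eigenspace_on H T \<mu>. cinner (x j - p) w = 0)"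
  proof
    fix j assume "j \<in> {..<n}"
    then have "x j \<in> H" using x by (auto simp: almost_eigenvectors_def)
    then show "\<exists>p. p \<in> eigenspace_on H T \<mu> \<and> norm (x j - p) \<le> 2 / r * norm (T (x j) - \<mu> *\<^sub>C x j) \<and>
      (\<forall>w\<in>eigenspace_on H T \<mu>. cinner (x j - p) w = 0)"
      using isolated_eigenvector_near[OF r gap] by metis
  qed
  from bchoice[OF this] obtain p where p: "\<And>j. j < n \<Longrightarrow> p j \<in> eigenspace_on H T \<mu>"
    "\<And>j. j < n \<Longrightarrow> norm (x j - p j) \<le> 2 / r * norm (T (x j) - \<mu> *\<^sub>C x j)"
    "\<And>j w. j < n \<Longrightarrow> w \<in> eigenspace_on H T \<mu> \<Longrightarrow> cinner (x j - p j) w = 0" by blast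
  show ?thesis
  proof (rule almost_orthonormal_split_cdim_ge[where x = x and y = p and z = "\<lambda>j. x j - p j"])
    fix j assume j: "j < n"
    have "2 / r * norm (T (x j) - \<mu> *\<^sub>C x j) \<le> 2 / r * \<eta>"
      using x j r by (intro mult_left_mono) (auto simp: almost_eigenvectors_def)
    then show "norm (x j - p j) \<le> 2 / r * \<eta>" using p(2)[OF j] by simp
  qed (use p x \<eta> csubspace_eigenspace in \<open>auto simp: almost_eigenvectors_def\<close>)
qed

end

section \<open>Spectral projections of discs\<close>

text \<open>Compactness makes the spectrum a bounded Borel set, so that the identity function is
  integrable for every measure \<open>\<nu> x\<close>.\<close>

locale spectral_measure = normal_operator H T S
  for H :: "'a::complex_hilbert_space set" and T S :: "'a \<Rightarrow> 'a" +
  fixes E :: "complex set \<Rightarrow> 'a \<Rightarrow> 'a"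
  assumes spectral: "is_spectral_measure_on H T E"
    and compact_spectrum: "compact (spectrum_on H T)"
begin

abbreviation \<nu> :: "'a \<Rightarrow> complex measure" where
  "\<nu> \<equiv> scalar_spectral_measure E"

lemma projection: "B \<in> sets borel \<Longrightarrow> orthogonal_projection_on H (E B)"
  and E_UNIV: "x \<in> H \<Longrightarrow> E UNIV x = x"
  and E_spectrum: "x \<in> H \<Longrightarrow> E (spectrum_on H T) x = x"
  and E_Int: "A \<in> sets borel \<Longrightarrow> B \<in> sets borel \<Longrightarrow> x \<in> H \<Longrightarrow> E (A \<inter> B) x = E A (E B x)"
  and E_sums: "range C \<subseteq> sets borel \<Longrightarrow> disjoint_family C \<Longrightarrow> x \<in> H \<Longrightarrow>
    (\<lambda>n. E (C n) x) sums E (\<Union>n. C n) x"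
  and cinner_T_self: "x \<in> H \<Longrightarrow> cinner (T x) x = integral\<^sup>L (\<nu> x) (\<lambda>z. z)"
  using spectral unfolding is_spectral_measure_on_def by blast+

lemma E_mem [simp, intro]: "B \<in> sets borel \<Longrightarrow> x \<in> H \<Longrightarrow> E B x \<in> H"
  and E_add: "B \<in> sets borel \<Longrightarrow> x \<in> H \<Longrightarrow> y \<in> H \<Longrightarrow> E B (x + y) = E B x + E B y"
  and E_scaleC: "B \<in> sets borel \<Longrightarrow> x \<in> H \<Longrightarrow> E B (c *\<^sub>C x) = c *\<^sub>C E B x"
  and E_E: "B \<in> sets borel \<Longrightarrow> x \<in> H \<Longrightarrow> E B (E B x) = E B x"
  and cinner_E: "B \<in> sets borel \<Longrightarrow> x \<in> H \<Longrightarrow> y \<in> H \<Longrightarrow> cinner (E B x) y = cinner x (E B y)"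
  using projection[of B]
  unfolding orthogonal_projection_on_def is_adjoint_on_def bounded_op_on_def linear_op_on_def
  by blast+

lemma E_empty: "x \<in> H \<Longrightarrow> E {} x = 0"
  using E_sums[of "\<lambda>_. {}" x] by (auto simp: disjoint_family_on_def summable_const_iff dest!: sums_summable)

lemma E_Compl:
  assumes B: "B \<in> sets borel" and x: "x \<in> H"
  shows "E B x + E (- B) x = x"
proof -
  let ?C = "\<lambda>n::nat. if n = 0 then B else if n = 1 then - B else {}"
  have "(\<lambda>n. E (?C n) x) sums E (\<Union>n. ?C n) x"
    using B x by (intro E_sums) (auto simp: disjoint_family_on_def)
  moreover have "(\<Union>n. ?C n) = UNIV"
  proof -
    have "z \<in> ?C 0 \<union> ?C 1" for z by simp
    then show ?thesis by blast
  qed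
  moreover have "(\<lambda>n. E (?C n) x) sums (\<Sum>n\<in>{0, 1}. E (?C n) x)"
    by (rule sums_finite) (auto simp: E_empty x)
  ultimately show ?thesis using x by (simp add: E_UNIV sums_iff)
qed

lemma cinner_E_self: "B \<in> sets borel \<Longrightarrow> x \<in> H \<Longrightarrow> cinner (E B x) x = complex_of_real ((norm (E B x))\<^sup>2)"
  using cinner_E[of B "E B x" x] by (simp add: E_E cinner_self)

lemma sets_\<nu> [simp, measurable_cong]: "sets (\<nu> x) = sets borel"
  unfolding scalar_spectral_measure_def using sets.sets_measure_of_eq[of borel] by simp

lemma space_\<nu> [simp]: "space (\<nu> x) = UNIV"
  using sets_eq_imp_space_eq[OF sets_\<nu>] by simp

lemma emeasure_\<nu>:
  assumes x: "x \<in> H" and B: "B \<in> sets borel"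
  shows "emeasure (\<nu> x) B = ennreal ((norm (E B x))\<^sup>2)"
proof -
  let ?f = "\<lambda>B. ennreal (Re (cinner (E B x) x))"
  have f: "?f B = ennreal ((norm (E B x))\<^sup>2)" if "B \<in> sets borel" for B
    using cinner_E_self[OF that x] by simp
  have "emeasure (\<nu> x) B = ?f B"
    unfolding scalar_spectral_measure_def
  proof (rule emeasure_measure_of_sigma)
    show "sigma_algebra UNIV (sets (borel :: complex measure))"
      using sets.sigma_algebra_axioms[of borel] by simp
    show "positive (sets borel) ?f" by (simp add: positive_def E_empty x cinner.zero_left)
    show "countably_additive (sets borel) ?f"
    proof (rule countably_additiveI)
      fix C :: "nat \<Rightarrow> complex set"
      assume C: "range C \<subseteq> sets borel" "disjoint_family C"
      have "(\<lambda>n. Re (cinner (E (C n) x) x)) sums Re (cinner (E (\<Union>n. C n) x) x)"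
        by (intro sums_Re bounded_linear.sums[OF cinner.bounded_linear_left] E_sums C x)
      moreover have "0 \<le> Re (cinner (E (C n) x) x)" for n
        using cinner_E_self[of "C n" x] C x by (simp add: image_subset_iff)
      ultimately show "(\<Sum>n. ?f (C n)) = ?f (\<Union>n. C n)" by (intro suminf_ennreal_eq) auto
    qed
  qed (rule B)
  then show ?thesis using f[OF B] by simp
qed

lemma finite_measure_\<nu>: "x \<in> H \<Longrightarrow> finite_measure (\<nu> x)"
  by (rule finite_measureI) (simp add: emeasure_\<nu>)

lemma measure_\<nu>_UNIV: "x \<in> H \<Longrightarrow> measure (\<nu> x) UNIV = (norm x)\<^sup>2"
  by (simp add: measure_def emeasure_\<nu> E_UNIV)

lemma AE_\<nu>:
  assumes "x \<in> H" "C \<in> sets borel" "E C x = x"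
  shows "AE z in \<nu> x. z \<in> C"
proof (rule AE_I)
  have "E (- C) x = 0" using E_Compl[of C x] assms by simp
  then show "emeasure (\<nu> x) (- C) = 0" using assms by (simp add: emeasure_\<nu>)
qed (use assms in auto)

lemma integrable_\<nu>:
  assumes "x \<in> H"
  shows "integrable (\<nu> x) (\<lambda>z. z)"
proof -
  obtain b where "\<And>z. z \<in> spectrum_on H T \<Longrightarrow> norm z \<le> b"
    using compact_imp_bounded[OF compact_spectrum] unfolding bounded_iff by blast
  moreover have "AE z in \<nu> x. z \<in> spectrum_on H T"
    using assms compact_spectrum by (intro AE_\<nu>) (auto simp: E_spectrum intro: borel_compact)
  ultimately have "AE z in \<nu> x. norm z \<le> b" by (auto elim: AE_mp)
  then show ?thesis
    by (intro finite_measure.integrable_const_bound[OF finite_measure_\<nu>[OF assms]]) auto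
qed

text \<open>Multiplicativity of \<open>E\<close> turns projecting the vector into restricting the
  measure, so quadratic forms on ranges of projections become integrals over sets.\<close>

lemma \<nu>_E:
  assumes x: "x \<in> H" and C: "C \<in> sets borel"
  shows "\<nu> (E C x) = density (\<nu> x) (\<lambda>z. ennreal (indicator C z))"
proof (rule measure_eqI)
  fix B assume "B \<in> sets (\<nu> (E C x))"
  then have B: "B \<in> sets borel" by simp
  have "emeasure (density (\<nu> x) (\<lambda>z. ennreal (indicator C z))) B =
      (\<integral>\<^sup>+z. ennreal (indicator C z) * indicator B z \<partial>\<nu> x)"
    using B C by (intro emeasure_density) auto
  also have "\<dots> = (\<integral>\<^sup>+z. indicator (B \<inter> C) z \<partial>\<nu> x)"
    by (intro nn_integral_cong) (auto simp: indicator_def)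
  also have "\<dots> = emeasure (\<nu> x) (B \<inter> C)" using B C by simp
  also have "\<dots> = emeasure (\<nu> (E C x)) B"
    using B C x by (simp add: emeasure_\<nu> E_Int)
  finally show "emeasure (\<nu> (E C x)) B = emeasure (density (\<nu> x) (\<lambda>z. ennreal (indicator C z))) B" ..
qed simp

lemma cinner_T_split:
  assumes x: "x \<in> H" and C: "C \<in> sets borel"
  shows "cinner (T x) x = cinner (T (E C x)) (E C x) + cinner (T (E (- C) x)) (E (- C) x)"
proof -
  have eq: "cinner (T (E C x)) (E C x) = (\<integral>z. indicator C z *\<^sub>R z \<partial>\<nu> x)" if C: "C \<in> sets borel" for C
    using x C by (simp add: cinner_T_self \<nu>_E integral_density)
  have int: "integrable (\<nu> x) (\<lambda>z. indicator C z *\<^sub>R z)" if "C \<in> sets borel" for C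
    using that integrable_\<nu>[OF x] by (intro integrable_mult_indicator) auto
  have "cinner (T x) x = (\<integral>z. indicator C z *\<^sub>R z + indicator (- C) z *\<^sub>R z \<partial>\<nu> x)"
    unfolding cinner_T_self[OF x] by (intro Bochner_Integration.integral_cong) (auto simp: indicator_def)
  also have "\<dots> = cinner (T (E C x)) (E C x) + cinner (T (E (- C) x)) (E (- C) x)"
    using C by (simp add: eq int Bochner_Integration.integral_add)
  finally show ?thesis .
qed

lemma E_Compl_zero: "C \<in> sets borel \<Longrightarrow> x \<in> H \<Longrightarrow> E C x = x \<Longrightarrow> E (- C) x = 0"
  using E_Compl[of C x] by simp

text \<open>The spectral measure is only tied to \<open>T\<close> through quadratic forms, so that \<open>T\<close> commutes with \<open>E C\<close> has
  to be recovered: \<open>\<langle>Tx, x\<rangle>\<close> splits along \<open>C\<close>, hence the cross terms vanish.\<close>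

lemma cinner_T_orthogonal:
  assumes C: "C \<in> sets borel" and u: "u \<in> H" "E C u = u" and v: "v \<in> H" "E (- C) v = v"
  shows "cinner (T u) v = 0"
proof -
  have cross: "cinner (T u) (c *\<^sub>C v) + cinner (T (c *\<^sub>C v)) u = 0" for c
  proof -
    have "E C v = 0" using E_Compl_zero[of "- C" v] C v by simp
    then have "E C (u + c *\<^sub>C v) = u" "E (- C) (u + c *\<^sub>C v) = c *\<^sub>C v"
      using C u v by (simp_all add: E_add E_scaleC E_Compl_zero scaleC.zero_right)
    then show ?thesis
      using cinner_T_split[of "u + c *\<^sub>C v" C] C u v by (simp add: T_add cinner.add_left cinner.add_right add.commute)
  qed
  \<comment> \<open>\<open>c = 1\<close> shows that the sum of the two cross terms vanishes,
    \<open>c = \<i>\<close> that their difference does.\<close>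
  have "cinner (T u) v + cinner (T v) u = 0" using cross[of 1] by (simp add: scaleC_one)
  moreover have "- \<i> * cinner (T u) v + \<i> * cinner (T v) u = 0"
    using cross[of \<i>] v by (simp add: T_scaleC cinner_simps)
  then have "\<i> * (cinner (T v) u - cinner (T u) v) = 0" by (simp add: algebra_simps)
  then have "cinner (T v) u = cinner (T u) v" by simp
  ultimately show ?thesis by simp
qed

text \<open>The component of \<open>T u\<close> in the range of \<open>E (- C)\<close> is orthogonal
  to itself.\<close>

lemma E_T_invariant:
  assumes C: "C \<in> sets borel" and u: "u \<in> H" "E C u = u"
  shows "E C (T u) = T u"
proof -
  define v where "v = E (- C) (T u)"
  have v: "v \<in> H" "E (- C) v = v" using C u by (auto simp: v_def E_E)
  have "cinner v v = cinner (T u) (E (- C) v)"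
    unfolding v_def using C u by (intro cinner_E) auto
  also have "\<dots> = 0" using cinner_T_orthogonal[OF C u v] v(2) by simp
  finally have "v = 0" by (simp add: cinner_self)
  then show ?thesis using E_Compl[of C "T u"] C u by (simp add: v_def)
qed

lemma E_shift_invariant:
  assumes "C \<in> sets borel" "u \<in> H" "E C u = u"
  shows "E C (T u - \<mu> *\<^sub>C u) = T u - \<mu> *\<^sub>C u"
proof -
  define w where "w = (- \<mu>) *\<^sub>C u"
  have "w \<in> H" "E C w = w" using assms by (auto simp only: w_def E_scaleC mem_H)
  then have "E C (T u + w) = T u + w" using assms by (simp add: E_add E_T_invariant)
  then show ?thesis by (simp add: w_def scaleC.minus_left)
qed

lemma E_orthogonal:
  assumes "C \<in> sets borel" "u \<in> H" "E C u = u" "v \<in> H" "E (- C) v = v"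
  shows "cinner u v = 0"
  using cinner_E[of C u v] E_Compl_zero[of "- C" v] assms by (simp add: cinner.zero_right)

lemma E_mono:
  assumes "C \<in> sets borel" "D \<in> sets borel" "C \<subseteq> D" "u \<in> H" "E C u = u"
  shows "E D u = u"
  using E_Int[of D C u] assms by (simp add: Int_absorb1)

lemma cinner_shift_self:
  assumes "u \<in> H"
  shows "cinner (T u - \<mu> *\<^sub>C u) u = (\<integral>z. z - \<mu> \<partial>\<nu> u)" and "integrable (\<nu> u) (\<lambda>z. z - \<mu>)"
proof -
  interpret finite_measure "\<nu> u" using assms by (rule finite_measure_\<nu>)
  show "integrable (\<nu> u) (\<lambda>z. z - \<mu>)" using integrable_\<nu>[OF assms] by simp
  show "cinner (T u - \<mu> *\<^sub>C u) u = (\<integral>z. z - \<mu> \<partial>\<nu> u)"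
    using integrable_\<nu>[OF assms] assms
    by (simp add: Bochner_Integration.integral_diff cinner_simps cinner_T_self measure_\<nu>_UNIV cinner_self
        scaleR_conv_of_real mult.commute)
qed

text \<open>The quadratic form averages \<open>z - \<mu>\<close> over \<open>C\<close>. An average
  over all directions may cancel, hence the restriction to one side of a line; \<open>c\<close>
  selects the direction.\<close>

lemma halfplane_bounded_below:
  assumes C: "C \<in> sets borel" and u: "u \<in> H" "E C u = u" and c: "cmod c = 1"
    and a: "\<And>z. z \<in> C \<Longrightarrow> a \<le> Re (c * (z - \<mu>))"
  shows "a * norm u \<le> norm (T u - \<mu> *\<^sub>C u)"
proof -
  interpret finite_measure "\<nu> u" using u(1) by (rule finite_measure_\<nu>)
  have int: "integrable (\<nu> u) (\<lambda>z. c * (z - \<mu>))" using cinner_shift_self(2)[OF u(1)] by simp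
  have "a * (norm u)\<^sup>2 = (\<integral>z. a \<partial>\<nu> u)" using u by (simp add: measure_\<nu>_UNIV)
  also have "\<dots> \<le> (\<integral>z. Re (c * (z - \<mu>)) \<partial>\<nu> u)"
  proof (rule integral_mono_AE)
    show "AE z in \<nu> u. a \<le> Re (c * (z - \<mu>))"
      using AE_\<nu>[OF u(1) C u(2)] by eventually_elim (rule a)
    show "integrable (\<nu> u) (\<lambda>z. Re (c * (z - \<mu>)))" using int by (rule integrable_Re)
  qed simp
  also have "\<dots> = Re (c * cinner (T u - \<mu> *\<^sub>C u) u)"
    using integral_Re[OF int] cinner_shift_self[OF u(1)] by simp
  also have "\<dots> \<le> cmod (cinner (T u - \<mu> *\<^sub>C u) u)"
    using complex_Re_le_cmod[of "c * cinner (T u - \<mu> *\<^sub>C u) u"] c by (simp add: norm_mult)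
  also have "\<dots> \<le> norm (T u - \<mu> *\<^sub>C u) * norm u" by (rule cmod_cinner_le)
  finally have "a * norm u * norm u \<le> norm (T u - \<mu> *\<^sub>C u) * norm u"
    by (simp add: power2_eq_square)
  then show ?thesis by (cases "u = 0") auto
qed

text \<open>The measures of vectors in the range of the projection live on the disc, which bounds
  the quadratic form of \<open>T - \<mu>\<close> by \<open>\<delta>\<close>. Polarization stays
  inside this range because \<open>T - \<mu>\<close> preserves it.\<close>

lemma ball_bounded_above:
  assumes \<delta>: "\<delta> > 0" and u: "u \<in> H" "E (ball \<mu> \<delta>) u = u"
  shows "norm (T u - \<mu> *\<^sub>C u) \<le> 2 * \<delta> * norm u"
proof -
  interpret M: normal_operator H "\<lambda>x. T x - \<mu> *\<^sub>C x" "\<lambda>x. S x - cnj \<mu> *\<^sub>C x"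
    by (rule shift)
  let ?B = "ball \<mu> \<delta>"
  let ?V = "{u \<in> H. E ?B u = u}"
  define y where "y = T u - \<mu> *\<^sub>C u"
  have B: "?B \<in> sets borel" by simp
  have E0: "E ?B 0 = 0" using E_add[OF B, of 0 0] by simp
  have V: "csubspace ?V"
    by (rule complex_vector.subspaceI) (auto simp: E_add[OF B] E_scaleC[OF B] E0)
  have yV: "y \<in> ?V" using u E_shift_invariant[OF B] by (auto simp: y_def)
  have bound: "cmod (cinner (T w - \<mu> *\<^sub>C w) w) \<le> \<delta> * (norm w)\<^sup>2" if w: "w \<in> ?V" for w
  proof -
    have wH: "w \<in> H" using w by simp
    interpret finite_measure "\<nu> w" using wH by (rule finite_measure_\<nu>)
    have "cmod (cinner (T w - \<mu> *\<^sub>C w) w) \<le> (\<integral>z. norm (z - \<mu>) \<partial>\<nu> w)"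
      unfolding cinner_shift_self(1)[OF wH] by (rule integral_norm_bound)
    also have "\<dots> \<le> (\<integral>z. \<delta> \<partial>\<nu> w)"
    proof (rule integral_mono_AE)
      have "AE z in \<nu> w. z \<in> ?B" using w by (intro AE_\<nu>) auto
      then show "AE z in \<nu> w. norm (z - \<mu>) \<le> \<delta>"
        by eventually_elim (simp add: dist_norm norm_minus_commute)
      show "integrable (\<nu> w) (\<lambda>z. norm (z - \<mu>))"
        using cinner_shift_self(2)[OF wH] by (rule integrable_norm)
    qed simp
    also have "\<dots> = \<delta> * (norm w)\<^sup>2" using wH by (simp add: measure_\<nu>_UNIV)
    finally show ?thesis .
  qed
  \<comment> \<open>The factor \<open>1 / (2 * \<delta>)\<close> is the \<open>t\<close> that
    maximizes \<open>t - \<delta> * t\<^sup>2\<close>, the coefficient left for the square of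
    \<open>norm y\<close>.\<close>
  have "cmod (cinner (T u - \<mu> *\<^sub>C u) ((1 / (2 * \<delta>)) *\<^sub>R y)) \<le>
      \<delta> * (norm u)\<^sup>2 + \<delta> * (norm ((1 / (2 * \<delta>)) *\<^sub>R y))\<^sup>2"
  proof (rule cinner_polarization_bound[OF V])
    show "\<delta> * (norm (x + z))\<^sup>2 + \<delta> * (norm (x - z))\<^sup>2 = 2 * (\<delta> * (norm x)\<^sup>2) + 2 * (\<delta> * (norm z)\<^sup>2)" for x z :: 'a
      using arg_cong[OF parallelogram_law[of x z], of "\<lambda>t. \<delta> * t"] by (simp add: algebra_simps)
    show "(1 / (2 * \<delta>)) *\<^sub>R y \<in> ?V" using V yV by (rule csubspace_scaleR)
  qed (use M.T_add M.T_scaleC u bound in \<open>auto simp: norm_scaleC\<close>)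
  moreover have "cmod (cinner (T u - \<mu> *\<^sub>C u) ((1 / (2 * \<delta>)) *\<^sub>R y)) = (norm y)\<^sup>2 / (2 * \<delta>)"
    using \<delta> unfolding y_def[symmetric] cinner_scaleR_right cinner_self by (simp add: norm_power)
  moreover have "\<delta> * (norm ((1 / (2 * \<delta>)) *\<^sub>R y))\<^sup>2 = (norm y)\<^sup>2 / (4 * \<delta>)"
    using \<delta> by (simp add: power_divide power_mult_distrib power2_eq_square)
  ultimately have "(norm y)\<^sup>2 / (2 * \<delta>) \<le> \<delta> * (norm u)\<^sup>2 + (norm y)\<^sup>2 / (4 * \<delta>)" by simp
  then have "(norm y)\<^sup>2 \<le> (2 * \<delta> * norm u)\<^sup>2"
    using \<delta> by (simp add: field_simps power2_eq_square)
  then show ?thesis unfolding y_def by (rule power2_le_imp_le) (use \<delta> in simp)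
qed

lemma norm_shift_split:
  assumes C: "C \<in> sets borel" and u: "u \<in> H"
  shows "(norm (T u - \<mu> *\<^sub>C u))\<^sup>2 =
    (norm (T (E C u) - \<mu> *\<^sub>C E C u))\<^sup>2 + (norm (T (E (- C) u) - \<mu> *\<^sub>C E (- C) u))\<^sup>2"
proof -
  interpret M: normal_operator H "\<lambda>x. T x - \<mu> *\<^sub>C x" "\<lambda>x. S x - cnj \<mu> *\<^sub>C x"
    by (rule shift)
  have C': "- C \<in> sets borel" using C by simp
  have "T u - \<mu> *\<^sub>C u = (T (E C u) - \<mu> *\<^sub>C E C u) + (T (E (- C) u) - \<mu> *\<^sub>C E (- C) u)"
    using M.T_add[of "E C u" "E (- C) u"] C C' u by (simp add: E_Compl)
  moreover have "cinner (T (E C u) - \<mu> *\<^sub>C E C u) (T (E (- C) u) - \<mu> *\<^sub>C E (- C) u) = 0"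
  proof (rule E_orthogonal[OF C])
    show "E C (T (E C u) - \<mu> *\<^sub>C E C u) = T (E C u) - \<mu> *\<^sub>C E C u"
      by (rule E_shift_invariant) (use C u in \<open>auto simp: E_E\<close>)
    show "E (- C) (T (E (- C) u) - \<mu> *\<^sub>C E (- C) u) = T (E (- C) u) - \<mu> *\<^sub>C E (- C) u"
      by (rule E_shift_invariant) (use C' u in \<open>auto simp: E_E\<close>)
  qed (use C C' u in auto)
  ultimately show ?thesis by (simp only: norm_add_cinner_zero)
qed

lemma norm_split:
  assumes C: "C \<in> sets borel" and u: "u \<in> H"
  shows "(norm u)\<^sup>2 = (norm (E C u))\<^sup>2 + (norm (E (- C) u))\<^sup>2"
proof -
  have "cinner (E C u) (E (- C) u) = 0"
    by (rule E_orthogonal[OF C]) (use C u in \<open>auto simp: E_E\<close>)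
  from norm_add_cinner_zero[OF this] show ?thesis using E_Compl[OF C u] by simp
qed

text \<open>The part of \<open>u\<close> off \<open>C\<close> lies in the range of
  \<open>E D\<close>. Pythagoras for \<open>u\<close> and for its image under
  \<open>T - \<mu>\<close> keeps the constant \<open>a\<close>.\<close>

lemma bounded_below_Un:
  assumes C: "C \<in> sets borel" and D: "D \<in> sets borel" and a: "a \<ge> 0"
    and lbC: "\<And>u. u \<in> H \<Longrightarrow> E C u = u \<Longrightarrow> a * norm u \<le> norm (T u - \<mu> *\<^sub>C u)"
    and lbD: "\<And>u. u \<in> H \<Longrightarrow> E D u = u \<Longrightarrow> a * norm u \<le> norm (T u - \<mu> *\<^sub>C u)"
    and u: "u \<in> H" "E (C \<union> D) u = u"
  shows "a * norm u \<le> norm (T u - \<mu> *\<^sub>C u)"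
proof -
  have "E (- C) u = E (- C \<inter> (C \<union> D)) u" using E_Int[of "- C" "C \<union> D" u] C D u by simp
  also have "- C \<inter> (C \<union> D) = D \<inter> - C" by blast
  also have "E (D \<inter> - C) u = E D (E (- C) u)" using C D u by (intro E_Int) auto
  finally have ED: "E D (E (- C) u) = E (- C) u" ..
  have "(a * norm (E C u))\<^sup>2 \<le> (norm (T (E C u) - \<mu> *\<^sub>C E C u))\<^sup>2"
    using lbC[of "E C u"] C u a by (intro power_mono) (auto simp: E_E)
  moreover have "(a * norm (E (- C) u))\<^sup>2 \<le> (norm (T (E (- C) u) - \<mu> *\<^sub>C E (- C) u))\<^sup>2"
    using lbD[of "E (- C) u"] C u a ED by (intro power_mono) auto
  moreover have "(a * norm u)\<^sup>2 = (a * norm (E C u))\<^sup>2 + (a * norm (E (- C) u))\<^sup>2"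
    unfolding power_mult_distrib norm_split[OF C u(1)] by (simp add: distrib_left)
  ultimately have "(a * norm u)\<^sup>2 \<le> (norm (T u - \<mu> *\<^sub>C u))\<^sup>2"
    unfolding norm_shift_split[OF C u(1)] by linarith
  then show ?thesis by (rule power2_le_imp_le) simp
qed

text \<open>Off the disc one of four half-planes at distance \<open>\<rho>/2\<close> applies, and lower bounds pass to unions by
  orthogonality.\<close>

lemma ball_Compl_bounded_below:
  assumes \<rho>: "\<rho> > 0" and u: "u \<in> H" "E (- ball \<mu> \<rho>) u = u"
  shows "\<rho> / 2 * norm u \<le> norm (T u - \<mu> *\<^sub>C u)"
proof -
  define C where "C c = {z. \<rho> / 2 \<le> Re (c * (z - \<mu>))}" for c
  have C: "C c \<in> sets borel" for c
    unfolding C_def by (intro borel_closed closed_Collect_le continuous_intros)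
  have lb: "\<rho> / 2 * norm v \<le> norm (T v - \<mu> *\<^sub>C v)" if "cmod c = 1" "v \<in> H" "E (C c) v = v" for c v
    using C that by (intro halfplane_bounded_below) (auto simp: C_def)
  have \<rho>2: "\<rho> / 2 \<ge> 0" using \<rho> by simp
  have lb2: "\<rho> / 2 * norm v \<le> norm (T v - \<mu> *\<^sub>C v)" if "v \<in> H" "E (C \<i> \<union> C (- \<i>)) v = v" for v
    by (rule bounded_below_Un[OF C C \<rho>2 lb lb that]) simp_all
  have lb3: "\<rho> / 2 * norm v \<le> norm (T v - \<mu> *\<^sub>C v)"
    if "v \<in> H" "E (C (-1) \<union> (C \<i> \<union> C (- \<i>))) v = v" for v
    by (rule bounded_below_Un[OF C _ \<rho>2 lb lb2 that]) (simp_all add: C sets.Un)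
  have Un: "\<rho> / 2 * norm v \<le> norm (T v - \<mu> *\<^sub>C v)"
    if "v \<in> H" "E (C 1 \<union> (C (-1) \<union> (C \<i> \<union> C (- \<i>)))) v = v" for v
    by (rule bounded_below_Un[OF C _ \<rho>2 lb lb3 that]) (simp_all add: C sets.Un)
  have "- ball \<mu> \<rho> \<subseteq> C 1 \<union> (C (-1) \<union> (C \<i> \<union> C (- \<i>)))"
  proof
    fix z assume "z \<in> - ball \<mu> \<rho>"
    \<comment> \<open>One of the two absolute values is at least half of \<open>\<rho>\<close>,
      which is the source of the factor \<open>1 / 2\<close>.\<close>
    then have "\<rho> \<le> \<bar>Re (z - \<mu>)\<bar> + \<bar>Im (z - \<mu>)\<bar>"
      using cmod_le[of "z - \<mu>"] by (simp add: dist_norm norm_minus_commute)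
    then show "z \<in> C 1 \<union> (C (-1) \<union> (C \<i> \<union> C (- \<i>)))" by (simp add: C_def) linarith
  qed
  then have "E (C 1 \<union> (C (-1) \<union> (C \<i> \<union> C (- \<i>)))) u = u"
    by (intro E_mono[OF _ _ _ u]) (simp_all add: C sets.Un)
  from Un[OF u(1) this] show ?thesis .
qed

lemma csubspace_E_image:
  assumes "C \<in> sets borel"
  shows "csubspace (E C ` H)"
proof -
  have "E C ` H = {u \<in> H. E C u = u}" using assms by (force simp: E_E image_iff)
  moreover have "E C 0 = 0" using E_add[OF assms, of 0 0] by simp
  ultimately show ?thesis
    by (auto intro!: complex_vector.subspaceI simp: E_add[OF assms] E_scaleC[OF assms])
qed

text \<open>By Pythagoras \<open>T - \<mu>\<close> is at most as large on the part of
  \<open>x j\<close> off the disc as on \<open>x j\<close>; there it is bounded below by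
  \<open>\<rho> / 2\<close>, so that part has norm at most
  \<open>2 / \<rho> * \<eta>\<close>.\<close>

lemma cdim_E_ball_ge:
  assumes \<rho>: "\<rho> > 0" and x: "almost_eigenvectors n \<mu> H T \<eta> x"
    and \<eta>: "real n * (\<eta> + (2 / \<rho> * \<eta>)\<^sup>2) < 1"
  shows "enat n \<le> cdim (E (ball \<mu> \<rho>) ` H)"
proof (rule almost_orthonormal_split_cdim_ge[where x = x])
  let ?B = "ball \<mu> \<rho>"
  have B: "?B \<in> sets borel" "- ?B \<in> sets borel" by auto
  have xH: "x j \<in> H" if "j < n" for j using x that by (simp add: almost_eigenvectors_def)
  show "csubspace (E ?B ` H)" using B(1) by (rule csubspace_E_image)
  show "x j = E ?B (x j) + E (- ?B) (x j)" if "j < n" for j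
    using E_Compl[OF B(1) xH[OF that]] by simp
  show "E ?B (x j) \<in> E ?B ` H" if "j < n" for j using xH[OF that] by blast
  show "cinner (E (- ?B) (x i)) (E ?B (x j)) = 0" if "i < n" "j < n" for i j
    by (rule E_orthogonal[OF B(2)]) (use B xH that in \<open>auto simp: E_E\<close>)
  show "norm (E (- ?B) (x j)) \<le> 2 / \<rho> * \<eta>" if j: "j < n" for j
  proof -
    define u where "u = E (- ?B) (x j)"
    have "\<rho> / 2 * norm u \<le> norm (T u - \<mu> *\<^sub>C u)"
      by (rule ball_Compl_bounded_below[OF \<rho>]) (use B xH[OF j] in \<open>auto simp: u_def E_E\<close>)
    also have "\<dots> \<le> norm (T (x j) - \<mu> *\<^sub>C x j)"
      using norm_shift_split[OF B(1) xH[OF j], of \<mu>] unfolding u_def[symmetric]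
      by (intro power2_le_imp_le[OF _ norm_ge_zero]) simp
    also have "\<dots> \<le> \<eta>" using x j by (simp add: almost_eigenvectors_def)
    finally show ?thesis using \<rho> unfolding u_def[symmetric] by (simp add: field_simps)
  qed
  show "cmod (cinner (x i) (x j) - of_bool (i = j)) \<le> \<eta>" if "i < n" "j < n" for i j
    using x that by (simp add: almost_eigenvectors_def)
qed (rule \<eta>)

lemma ex_almost_eigenvectors:
  assumes \<delta>: "\<delta> > 0" and n: "enat n \<le> cdim (E (ball \<mu> \<delta>) ` H)"
  shows "\<exists>x. almost_eigenvectors n \<mu> H T (2 * \<delta>) x"
proof -
  have B: "ball \<mu> \<delta> \<in> sets borel" by simp
  obtain x where x: "\<And>j. j < n \<Longrightarrow> x j \<in> E (ball \<mu> \<delta>) ` H"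
    "\<And>i j. i < n \<Longrightarrow> j < n \<Longrightarrow> cinner (x i) (x j) = of_bool (i = j)"
    using ex_orthonormal_family[OF csubspace_E_image[OF B] n] by blast
  have xH: "x j \<in> H" "E (ball \<mu> \<delta>) (x j) = x j" if "j < n" for j
    using x(1)[OF that] B by (auto simp: E_E)
  have norm_x: "norm (x j) = 1" if "j < n" for j
    using x(2)[OF that that] by (simp add: norm_eq_one_if_cinner_self)
  have "almost_eigenvectors n \<mu> H T (2 * \<delta>) x"
    unfolding almost_eigenvectors_def
  proof (intro allI impI conjI)
    fix j assume j: "j < n"
    show "x j \<in> H \<inter> cball 0 1" using xH norm_x j by simp
    show "norm (T (x j) - \<mu> *\<^sub>C x j) \<le> 2 * \<delta>"
      using ball_bounded_above[OF \<delta> xH[OF j]] norm_x[OF j] by simp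
    show "cmod (cinner (x i) (x j) - of_bool (i = j)) \<le> 2 * \<delta>" if "i < n" for i
      using x(2)[OF that j] \<delta> by simp
  qed
  then show ?thesis by blast
qed

end

section \<open>A sentence measuring the lack of eigenvectors\<close>

primrec inf_quantify :: "nat \<Rightarrow> fm \<Rightarrow> fm" where
  "inf_quantify 0 \<phi> = \<phi>"
| "inf_quantify (Suc n) \<phi> = InfQ n (inf_quantify n \<phi>)"

lemma wf_inf_quantify: "wf_fm (inf_quantify n \<phi>) = wf_fm \<phi>"
  by (induction n) auto

lemma fv_inf_quantify: "fv_fm (inf_quantify n \<phi>) = fv_fm \<phi> - {..<n}"
proof (induction n)
  case (Suc n)
  have "{..<Suc n} = {..<n} \<union> {n}" by auto
  then show ?case by (simp only: inf_quantify.simps fv_fm.simps Suc Diff_Un Diff_Diff_Int) blast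
qed simp

lemma fm_val_inf_quantify_nonneg:
  assumes "csubspace H" and "\<And>v. 0 \<le> fm_val H T \<phi> v"
  shows "0 \<le> fm_val H T (inf_quantify n \<phi>) v"
proof (induction n arbitrary: v)
  case (Suc n)
  have "H \<inter> cball 0 1 \<noteq> {}" using complex_vector.subspace_0[OF assms(1)] by force
  then show ?case by (auto intro!: cINF_greatest Suc)
qed (simp add: assms)

text \<open>An infimum over the unit ball need not be attained, so its value is described through
  strict upper bounds, which do have witnesses. Nonnegativity keeps the real infima
  meaningful.\<close>

lemma fm_val_inf_quantify_less_iff:
  assumes H: "csubspace H" and nonneg: "\<And>v. 0 \<le> fm_val H T \<phi> v"
  shows "fm_val H T (inf_quantify n \<phi>) v < e \<longleftrightarrow>
    (\<exists>w. (\<forall>j<n. w j \<in> H \<inter> cball 0 1) \<and> (\<forall>j\<ge>n. w j = v j) \<and> fm_val H T \<phi> w < e)"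
proof (induction n arbitrary: v)
  case 0
  have "(\<forall>j. w j = v j) \<longleftrightarrow> w = v" for w by auto
  then show ?case by simp
next
  case (Suc n)
  have ne: "H \<inter> cball 0 1 \<noteq> {}" using complex_vector.subspace_0[OF H] by force
  have bdd: "bdd_below ((\<lambda>x. fm_val H T (inf_quantify n \<phi>) (v(n := x))) ` (H \<inter> cball 0 1))"
    by (rule bdd_belowI2[of _ 0]) (rule fm_val_inf_quantify_nonneg[OF H nonneg])
  have "fm_val H T (inf_quantify (Suc n) \<phi>) v < e \<longleftrightarrow>
      (\<exists>x\<in>H \<inter> cball 0 1. fm_val H T (inf_quantify n \<phi>) (v(n := x)) < e)"
    unfolding inf_quantify.simps fm_val.simps by (rule cINF_less_iff[OF ne bdd])
  also have "\<dots> \<longleftrightarrow> (\<exists>x\<in>H \<inter> cball 0 1. \<exists>w. (\<forall>j<n. w j \<in> H \<inter> cball 0 1) \<and>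
      (\<forall>j\<ge>n. w j = (v(n := x)) j) \<and> fm_val H T \<phi> w < e)"
    by (simp only: Suc.IH)
  also have "\<dots> \<longleftrightarrow> (\<exists>w. (\<forall>j<Suc n. w j \<in> H \<inter> cball 0 1) \<and> (\<forall>j\<ge>Suc n. w j = v j) \<and> fm_val H T \<phi> w < e)"
  proof (intro iffI; elim bexE exE conjE)
    fix x w assume x: "x \<in> H \<inter> cball 0 1" and w: "\<forall>j<n. w j \<in> H \<inter> cball 0 1"
      "\<forall>j\<ge>n. w j = (v(n := x)) j" "fm_val H T \<phi> w < e"
    then have "w n = x" by simp
    moreover have "\<forall>j\<ge>Suc n. w j = v j" using w(2) by auto
    ultimately show "\<exists>w. (\<forall>j<Suc n. w j \<in> H \<inter> cball 0 1) \<and> (\<forall>j\<ge>Suc n. w j = v j) \<and> fm_val H T \<phi> w < e"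
      using x w by (intro exI[of _ w]) (auto simp: less_Suc_eq)
  next
    fix w assume w: "\<forall>j<Suc n. w j \<in> H \<inter> cball 0 1" "\<forall>j\<ge>Suc n. w j = v j" "fm_val H T \<phi> w < e"
    have "\<forall>j\<ge>n. w j = (v(n := w n)) j" using w(2) by (auto simp: Suc_le_eq)
    moreover have "\<forall>j<n. w j \<in> H \<inter> cball 0 1" "w n \<in> H \<inter> cball 0 1" using w(1) by simp_all
    ultimately show "\<exists>x\<in>H \<inter> cball 0 1. \<exists>w. (\<forall>j<n. w j \<in> H \<inter> cball 0 1) \<and>
        (\<forall>j\<ge>n. w j = (v(n := x)) j) \<and> fm_val H T \<phi> w < e"
      using w(3) by blast
  qed
  finally show ?case .
qed

text \<open>Formulas are real-valued, so the modulus of an entry of the Gram matrix minus the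
  identity is replaced by the sum of its absolute real and imaginary parts, equivalent up to a
  factor two.\<close>

definition gram_fm :: "nat \<times> nat \<Rightarrow> fm" where
  "gram_fm p = Conn (\<lambda>g. \<bar>g 0 - of_bool (fst p = snd p)\<bar> + \<bar>g 1\<bar>)
     [ReInner (Var (fst p)) (Var (snd p)), ImInner (Var (fst p)) (Var (snd p))]"

text \<open>\<open>Comb \<mu> 0\<close> is scalar multiplication by \<open>\<mu>\<close>; it is a
  symbol of the language only for \<open>cmod \<mu> \<le> 1\<close>, whence the hypothesis of
  \<open>sentence_eigenvectors\<close>.\<close>

definition eigen_fm :: "complex \<Rightarrow> nat \<Rightarrow> fm" where
  "eigen_fm \<mu> j = Dist (Op (Var j)) (Comb \<mu> 0 (Var j) (Var j))"

definition sum_fm :: "fm list \<Rightarrow> fm" where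
  "sum_fm \<phi>s = Conn (\<lambda>g. \<Sum>j<length \<phi>s. g j) \<phi>s"

definition eigenvectors_fm :: "nat \<Rightarrow> complex \<Rightarrow> fm" where
  "eigenvectors_fm n \<mu> =
     sum_fm (map gram_fm (List.product [0..<n] [0..<n]) @ map (eigen_fm \<mu>) [0..<n])"

lemma fm_val_gram: "fm_val H T (gram_fm (i, j)) v =
    \<bar>Re (cinner (v i) (v j) - of_bool (i = j))\<bar> + \<bar>Im (cinner (v i) (v j) - of_bool (i = j))\<bar>"
  by (simp add: gram_fm_def)

lemma fm_val_eigen: "fm_val H T (eigen_fm \<mu> j) v = norm (T (v j) - \<mu> *\<^sub>C v j)"
  by (simp add: eigen_fm_def dist_norm scaleC.zero_left)

lemma fm_val_sum: "fm_val H T (sum_fm \<phi>s) v = (\<Sum>\<phi>\<leftarrow>\<phi>s. fm_val H T \<phi> v)"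
  by (simp add: sum_fm_def sum_list_sum_nth atLeast0LessThan)

lemma fm_val_eigenvectors: "fm_val H T (eigenvectors_fm n \<mu>) v =
    (\<Sum>p\<in>{..<n} \<times> {..<n}. fm_val H T (gram_fm p) v) + (\<Sum>j<n. fm_val H T (eigen_fm \<mu> j) v)"
proof -
  have "(\<Sum>p\<leftarrow>List.product [0..<n] [0..<n]. fm_val H T (gram_fm p) v) =
      (\<Sum>p\<in>{..<n} \<times> {..<n}. fm_val H T (gram_fm p) v)"
    by (subst sum_list_distinct_conv_sum_set) (simp_all add: distinct_product atLeast0LessThan)
  moreover have "(\<Sum>j\<leftarrow>[0..<n]. fm_val H T (eigen_fm \<mu> j) v) = (\<Sum>j<n. fm_val H T (eigen_fm \<mu> j) v)"
    by (subst sum_list_distinct_conv_sum_set) (simp_all add: atLeast0LessThan)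
  ultimately show ?thesis
    by (simp add: eigenvectors_fm_def fm_val_sum comp_def)
qed

lemma gram_nonneg: "0 \<le> fm_val H T (gram_fm p) v"
  by (cases p) (simp add: fm_val_gram)

lemma fm_val_eigenvectors_nonneg: "0 \<le> fm_val H T (eigenvectors_fm n \<mu>) v"
  unfolding fm_val_eigenvectors by (intro add_nonneg_nonneg sum_nonneg) (auto simp: gram_nonneg fm_val_eigen)

lemma sentence_eigenvectors:
  assumes "cmod \<mu> \<le> 1"
  shows "inf_quantify n (eigenvectors_fm n \<mu>) \<in> sentences"
proof -
  have gram: "wf_fm (gram_fm p)" for p
    by (auto simp: gram_fm_def intro!: continuous_intros)
  have "continuous_on UNIV (\<lambda>g::nat \<Rightarrow> real. \<Sum>j<k. g j)" for k
    by (intro continuous_intros continuous_on_product_coordinates)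
  then have "wf_fm (eigenvectors_fm n \<mu>)"
    using gram assms by (auto simp: eigenvectors_fm_def sum_fm_def list_all_iff eigen_fm_def)
  moreover have "fv_fm (eigenvectors_fm n \<mu>) \<subseteq> {..<n}"
    by (auto simp: eigenvectors_fm_def sum_fm_def gram_fm_def eigen_fm_def)
  ultimately show ?thesis by (auto simp: sentences_def wf_inf_quantify fv_inf_quantify)
qed

definition eigen_defect :: "nat \<Rightarrow> complex \<Rightarrow> 'a::complex_hilbert_space set \<Rightarrow> ('a \<Rightarrow> 'a) \<Rightarrow> real" where
  "eigen_defect n \<mu> H T = fm_val H T (inf_quantify n (eigenvectors_fm n \<mu>)) (\<lambda>_. 0)"

lemma eigen_defect_less_iff:
  assumes "csubspace H"
  shows "eigen_defect n \<mu> H T < e \<longleftrightarrow>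
    (\<exists>w. (\<forall>j<n. w j \<in> H \<inter> cball 0 1) \<and> fm_val H T (eigenvectors_fm n \<mu>) w < e)"
proof -
  \<comment> \<open>Variables from \<open>n\<close> on do not occur, so a witness may be reset to
    zero there.\<close>
  have "fm_val H T (eigenvectors_fm n \<mu>) (\<lambda>j. if j < n then w j else 0) = fm_val H T (eigenvectors_fm n \<mu>) w" for w
    unfolding fm_val_eigenvectors by (intro arg_cong2[of _ _ _ _ "(+)"] sum.cong) (auto simp: fm_val_gram fm_val_eigen)
  then have "(\<exists>w'. (\<forall>j<n. w' j \<in> H \<inter> cball 0 1) \<and> (\<forall>j\<ge>n. w' j = 0) \<and> fm_val H T (eigenvectors_fm n \<mu>) w' < e)"
    if "\<forall>j<n. w j \<in> H \<inter> cball 0 1" "fm_val H T (eigenvectors_fm n \<mu>) w < e" for w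
    using that by (intro exI[of _ "\<lambda>j. if j < n then w j else 0"]) simp
  then show ?thesis
    unfolding eigen_defect_def fm_val_inf_quantify_less_iff[OF assms fm_val_eigenvectors_nonneg] by blast
qed

lemma almost_eigenvectors_if_defect_less:
  assumes "csubspace H" "eigen_defect n \<mu> H T < \<eta>"
  shows "\<exists>x. almost_eigenvectors n \<mu> H T \<eta> x"
proof -
  obtain w where w: "\<forall>j<n. w j \<in> H \<inter> cball 0 1" and less: "fm_val H T (eigenvectors_fm n \<mu>) w < \<eta>"
    using assms eigen_defect_less_iff by blast
  have gram_sum: "0 \<le> (\<Sum>p\<in>{..<n} \<times> {..<n}. fm_val H T (gram_fm p) w)"
    and eigen_sum: "0 \<le> (\<Sum>j<n. fm_val H T (eigen_fm \<mu> j) w)"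
    by (intro sum_nonneg; simp add: gram_nonneg fm_val_eigen)+
  have "cmod (cinner (w i) (w j) - of_bool (i = j)) \<le> \<eta>" if "i < n" "j < n" for i j
  proof -
    have "cmod (cinner (w i) (w j) - of_bool (i = j)) \<le> fm_val H T (gram_fm (i, j)) w"
      unfolding fm_val_gram by (rule cmod_le)
    also have "\<dots> \<le> (\<Sum>p\<in>{..<n} \<times> {..<n}. fm_val H T (gram_fm p) w)"
      using that by (intro member_le_sum) (auto simp: gram_nonneg)
    finally show ?thesis using less eigen_sum unfolding fm_val_eigenvectors by linarith
  qed
  moreover have "norm (T (w j) - \<mu> *\<^sub>C w j) \<le> \<eta>" if "j < n" for j
  proof -
    have "fm_val H T (eigen_fm \<mu> j) w \<le> (\<Sum>j<n. fm_val H T (eigen_fm \<mu> j) w)"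
      using that by (intro member_le_sum) (auto simp: fm_val_eigen)
    then show ?thesis using less gram_sum unfolding fm_val_eigenvectors fm_val_eigen by linarith
  qed
  ultimately show ?thesis using w unfolding almost_eigenvectors_def by blast
qed

text \<open>The constant counts \<open>n * n\<close> Gram terms of at most \<open>2 * \<eta>\<close>
  and \<open>n\<close> eigenvector terms of at most \<open>\<eta>\<close>.\<close>

lemma defect_le_if_almost_eigenvectors:
  assumes H: "csubspace H" and x: "almost_eigenvectors n \<mu> H T \<eta> x"
  shows "eigen_defect n \<mu> H T \<le> (2 * (real n)\<^sup>2 + real n) * \<eta>"
proof (rule dense_ge)
  have "(\<Sum>p\<in>{..<n} \<times> {..<n}. fm_val H T (gram_fm p) x) \<le> real (card ({..<n} \<times> {..<n})) * (2 * \<eta>)"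
  proof (rule sum_bounded_above)
    fix p assume p: "p \<in> {..<n} \<times> {..<n}"
    obtain i j where ij: "p = (i, j)" by force
    have "cmod (cinner (x i) (x j) - of_bool (i = j)) \<le> \<eta>"
      using x p by (simp add: almost_eigenvectors_def ij)
    then show "fm_val H T (gram_fm p) x \<le> 2 * \<eta>"
      using abs_Re_le_cmod[of "cinner (x i) (x j) - of_bool (i = j)"]
        abs_Im_le_cmod[of "cinner (x i) (x j) - of_bool (i = j)"] unfolding ij fm_val_gram by linarith
  qed
  moreover have "(\<Sum>j<n. fm_val H T (eigen_fm \<mu> j) x) \<le> real (card {..<n}) * \<eta>"
    by (rule sum_bounded_above) (use x in \<open>simp add: almost_eigenvectors_def fm_val_eigen\<close>)
  ultimately have le: "fm_val H T (eigenvectors_fm n \<mu>) x \<le> (2 * (real n)\<^sup>2 + real n) * \<eta>"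
    unfolding fm_val_eigenvectors by (simp add: card_cartesian_product power2_eq_square algebra_simps)
  fix e assume "(2 * (real n)\<^sup>2 + real n) * \<eta> < e"
  then have "fm_val H T (eigenvectors_fm n \<mu>) x < e" using le by linarith
  moreover have "\<forall>j<n. x j \<in> H \<inter> cball 0 1" using x by (simp add: almost_eigenvectors_def)
  ultimately have "eigen_defect n \<mu> H T < e" using eigen_defect_less_iff[OF H] by blast
  then show "eigen_defect n \<mu> H T \<le> e" by simp
qed

lemma tendsto_eigen_defect:
  assumes "limitin logic_topology (\<lambda>i. complete_theory (Hs i) (Ts i)) (complete_theory H T) \<U>"
    and "cmod \<mu> \<le> 1"
  shows "((\<lambda>i. eigen_defect n \<mu> (Hs i) (Ts i)) \<longlongrightarrow> eigen_defect n \<mu> H T) \<U>"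
proof -
  let ?\<phi> = "inf_quantify n (eigenvectors_fm n \<mu>)"
  have \<phi>: "?\<phi> \<in> sentences" using assms(2) by (rule sentence_eigenvectors)
  then have "((\<lambda>i. complete_theory (Hs i) (Ts i) ?\<phi>) \<longlongrightarrow> complete_theory H T ?\<phi>) \<U>"
    using assms(1) unfolding logic_topology_def limitin_componentwise by simp
  then show ?thesis using \<phi> by (simp add: complete_theory_def eigen_defect_def)
qed

section \<open>Passage to the limit\<close>

lemma almost_eigenvectors_mono:
  "almost_eigenvectors n \<mu> H T \<eta> x \<Longrightarrow> \<eta> \<le> \<eta>' \<Longrightarrow> almost_eigenvectors n \<mu> H T \<eta>' x"
  unfolding almost_eigenvectors_def by (meson order_trans)

lemma models_normal_operator:
  assumes "models_normal H T"
  obtains S where "normal_operator H T S"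
  using assms unfolding models_normal_def hilbert_subspace_def normal_on_def normal_operator_def by metis

lemma infinite_cdim_nonzero:
  assumes "cdim H = \<infinity>"
  obtains x where "x \<in> H" "x \<noteq> 0"
proof -
  have "\<not> H \<subseteq> cspan {}" using assms unfolding cdim_def by (metis enat.distinct(1) finite.emptyI)
  then show thesis using that by auto
qed

context normal_operator
begin

lemma almost_eigenvector_normalize:
  assumes "x \<in> H" "norm (T x - \<mu> *\<^sub>C x) < \<eta> * norm x"
  shows "\<exists>y. almost_eigenvectors 1 \<mu> H T \<eta> y"
proof -
  interpret M: normal_operator H "\<lambda>x. T x - \<mu> *\<^sub>C x" "\<lambda>x. S x - cnj \<mu> *\<^sub>C x"
    by (rule shift)
  have x0: "x \<noteq> 0" using assms(2) by auto
  define y where "y = (1 / norm x) *\<^sub>R x"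
  have y: "y \<in> H" "norm y = 1" using assms x0 by (auto simp: y_def)
  have "norm (T y - \<mu> *\<^sub>C y) = norm (T x - \<mu> *\<^sub>C x) / norm x"
    unfolding y_def M.T_scaleR[OF assms(1)] by simp
  also have "\<dots> < \<eta>" using assms(2) x0 by (simp add: pos_divide_less_eq)
  finally have small: "norm (T y - \<mu> *\<^sub>C y) < \<eta>" .
  then have "\<eta> \<ge> 0" using norm_ge_zero[of "T y - \<mu> *\<^sub>C y"] by linarith
  then have "almost_eigenvectors 1 \<mu> H T \<eta> (\<lambda>_. y)"
    using y small by (simp add: almost_eigenvectors_def cinner_self)
  then show ?thesis by blast
qed

lemma spectrum_almost_eigenvector:
  assumes "\<mu> \<in> spectrum_on H T" "\<eta> > 0"
  shows "\<exists>y. almost_eigenvectors 1 \<mu> H T \<eta> y"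
proof (rule ccontr)
  assume none: "\<nexists>y. almost_eigenvectors 1 \<mu> H T \<eta> y"
  have "\<mu> \<notin> spectrum_on H T"
    by (rule notin_spectrum_if_bounded_below[OF assms(2)])
      (use none almost_eigenvector_normalize not_less in blast)
  then show False using assms(1) by blast
qed

lemma almost_eigenvector_lower_bound:
  assumes x: "almost_eigenvectors 1 \<mu> H T \<eta> x" and \<eta>: "\<eta> \<le> 1 / 2" and c: "c \<ge> 0"
    and below: "\<And>x. x \<in> H \<Longrightarrow> c * norm x \<le> norm (T x - \<mu> *\<^sub>C x)"
  shows "c \<le> 2 * \<eta>"
proof -
  have x0: "x 0 \<in> H" "norm (T (x 0) - \<mu> *\<^sub>C x 0) \<le> \<eta>" "cmod (cinner (x 0) (x 0) - 1) \<le> \<eta>"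
    using x by (simp_all add: almost_eigenvectors_def)
  have "complex_of_real ((norm (x 0))\<^sup>2) - 1 = complex_of_real ((norm (x 0))\<^sup>2 - 1)" by simp
  then have "\<bar>(norm (x 0))\<^sup>2 - 1\<bar> \<le> \<eta>"
    using x0(3) unfolding cinner_self by (simp only: norm_of_real)
  \<comment> \<open>The square is even at least \<open>1 / 2\<close>; the cruder
    \<open>1 / 4\<close> has a rational root.\<close>
  then have "(1 / 2)\<^sup>2 \<le> (norm (x 0))\<^sup>2" using \<eta> unfolding power2_eq_square[of "1 / 2"] by linarith
  then have "1 / 2 \<le> norm (x 0)" by (rule power2_le_imp_le) simp
  then have "c * (1 / 2) \<le> c * norm (x 0)" using c by (rule mult_left_mono)
  then show ?thesis using below[OF x0(1)] x0(2) by linarith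
qed

text \<open>The condition on \<open>r\<close> involves \<open>\<eta>\<close> alone and not the
  operator, so it serves all models at once; this comes from the lower bound by the
  distance.\<close>

lemma almost_eigenvector_imp_spectrum_near:
  assumes "almost_eigenvectors 1 \<mu> H T \<eta> x" "\<eta> \<le> 1 / 2" "2 * \<eta> < r" "r > 0"
  shows "ball \<mu> r \<inter> spectrum_on H T \<noteq> {}"
proof
  assume "ball \<mu> r \<inter> spectrum_on H T = {}"
  from almost_eigenvector_lower_bound[OF assms(1,2) _ bounded_below_by_distance[OF this]]
  show False using assms(3,4) by simp
qed

lemma no_almost_eigenvector_imp_spectrum_disjoint:
  assumes "\<nexists>x. almost_eigenvectors 1 \<mu> H T \<eta> x"
  shows "ball \<mu> \<eta> \<inter> spectrum_on H T = {}"
proof -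
  have "z \<notin> spectrum_on H T" if "z \<in> ball \<mu> \<eta>" for z
  proof (rule notin_spectrum_near)
    show "\<eta> * norm x \<le> norm (T x - \<mu> *\<^sub>C x)" if "x \<in> H" for x
      using almost_eigenvector_normalize[OF that] assms not_less by blast
    show "cmod (z - \<mu>) < \<eta>" using that by (simp add: dist_norm norm_minus_commute)
  qed
  then show ?thesis by blast
qed

lemma notin_spectrum_no_almost_eigenvector:
  assumes "\<mu> \<notin> spectrum_on H T"
  shows "\<exists>\<eta>>0. \<nexists>x. almost_eigenvectors 1 \<mu> H T \<eta> x"
proof -
  obtain c where c: "c > 0" "\<And>x. x \<in> H \<Longrightarrow> c * norm x \<le> norm (T x - \<mu> *\<^sub>C x)"
    using bounded_below_if_notin_spectrum[OF assms] by blast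
  have "\<nexists>x. almost_eigenvectors 1 \<mu> H T (min (1 / 2) (c / 4)) x"
  proof
    assume "\<exists>x. almost_eigenvectors 1 \<mu> H T (min (1 / 2) (c / 4)) x"
    then obtain x where "almost_eigenvectors 1 \<mu> H T (min (1 / 2) (c / 4)) x" by blast
    from almost_eigenvector_lower_bound[OF this min.cobounded1 less_imp_le[OF c(1)] c(2)]
    show False using c(1) min.cobounded2[of "1 / 2" "c / 4"] by linarith
  qed
  then show ?thesis using c(1) by (intro exI[of _ "min (1 / 2) (c / 4)"]) simp
qed

end

lemma ex_small_real: "\<exists>\<eta>>0. real n * (\<eta> + (a * \<eta>)\<^sup>2) < 1"
proof -
  have "((\<lambda>\<eta>. real n * (\<eta> + (a * \<eta>)\<^sup>2)) \<longlongrightarrow> real n * (0 + (a * 0)\<^sup>2)) (at_right 0)"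
    by (intro tendsto_intros)
  then have "eventually (\<lambda>\<eta>. real n * (\<eta> + (a * \<eta>)\<^sup>2) < 1) (at_right 0)"
    by (rule order_tendstoD(2)) simp
  moreover have "eventually (\<lambda>\<eta>::real. \<eta> > 0) (at_right 0)"
    by (rule eventually_at_right_less)
  ultimately have "eventually (\<lambda>\<eta>. 0 < \<eta> \<and> real n * (\<eta> + (a * \<eta>)\<^sup>2) < 1) (at_right 0)"
    by eventually_elim blast
  then show ?thesis using eventually_happens'[OF trivial_limit_at_right_real] by blast
qed

locale logic_limit =
  fixes \<U> :: "'i filter" and Hs :: "'i \<Rightarrow> 'a::complex_hilbert_space set" and Ts :: "'i \<Rightarrow> 'a \<Rightarrow> 'a"
    and H :: "'b::complex_hilbert_space set" and T :: "'b \<Rightarrow> 'b"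
  assumes \<U>: "\<U> \<noteq> bot"
    and models: "models_normal (Hs i) (Ts i)" and model: "models_normal H T"
    and limit: "limitin logic_topology (\<lambda>i. complete_theory (Hs i) (Ts i)) (complete_theory H T) \<U>"
begin

lemma csubspaces: "csubspace (Hs i)" "csubspace H"
  using models model by (simp_all add: models_normal_def hilbert_subspace_def)

lemma eventually_almost_eigenvectors:
  assumes \<mu>: "cmod \<mu> \<le> 1" and ex: "\<And>\<eta>. \<eta> > 0 \<Longrightarrow> \<exists>x. almost_eigenvectors n \<mu> H T \<eta> x"
    and \<eta>: "\<eta> > 0"
  shows "eventually (\<lambda>i. \<exists>x. almost_eigenvectors n \<mu> (Hs i) (Ts i) \<eta> x) \<U>"
proof -
  define c where "c = 2 * (real n)\<^sup>2 + real n"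
  have c: "c \<ge> 0" by (simp add: c_def)
  \<comment> \<open>The denominator \<open>c + 1\<close> keeps the defect strictly below
    \<open>\<eta>\<close>, also when \<open>c = 0\<close>.\<close>
  have "\<eta> / (c + 1) > 0" using \<eta> c by simp
  then obtain x where "almost_eigenvectors n \<mu> H T (\<eta> / (c + 1)) x" using ex by blast
  then have "eigen_defect n \<mu> H T \<le> c * (\<eta> / (c + 1))"
    unfolding c_def by (rule defect_le_if_almost_eigenvectors[OF csubspaces(2)])
  also have "\<dots> < \<eta>" using \<eta> c by (simp add: field_simps)
  finally have "eventually (\<lambda>i. eigen_defect n \<mu> (Hs i) (Ts i) < \<eta>) \<U>"
    by (rule order_tendstoD(2)[OF tendsto_eigen_defect[OF limit \<mu>]])
  then show ?thesis
    by (rule eventually_mono) (rule almost_eigenvectors_if_defect_less[OF csubspaces(1)])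
qed

text \<open>Stated with \<open>frequently\<close> so that its contrapositive
  \<open>eventually_no_almost_eigenvectors\<close> yields an eventual statement.\<close>

lemma limit_almost_eigenvectors:
  assumes \<mu>: "cmod \<mu> \<le> 1"
    and freq: "\<And>\<eta>. \<eta> > 0 \<Longrightarrow> frequently (\<lambda>i. \<exists>x. almost_eigenvectors n \<mu> (Hs i) (Ts i) \<eta> x) \<U>"
    and \<eta>: "\<eta> > 0"
  shows "\<exists>x. almost_eigenvectors n \<mu> H T \<eta> x"
proof (rule almost_eigenvectors_if_defect_less[OF csubspaces(2)], rule ccontr)
  define c where "c = 2 * (real n)\<^sup>2 + real n"
  have c: "c \<ge> 0" by (simp add: c_def)
  assume "\<not> eigen_defect n \<mu> H T < \<eta>"
  \<comment> \<open>Convergence transfers strict inequalities only, so half of \<open>\<eta>\<close>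
    is given up.\<close>
  then have "\<eta> / 2 < eigen_defect n \<mu> H T" using \<eta> by simp
  then have "eventually (\<lambda>i. \<eta> / 2 < eigen_defect n \<mu> (Hs i) (Ts i)) \<U>"
    by (rule order_tendstoD(1)[OF tendsto_eigen_defect[OF limit \<mu>]])
  moreover have "\<eta> / 2 / (c + 1) > 0" using \<eta> c by simp
  from freq[OF this]
  have "frequently (\<lambda>i. \<exists>x. almost_eigenvectors n \<mu> (Hs i) (Ts i) (\<eta> / 2 / (c + 1)) x) \<U>" .
  ultimately obtain i x where less: "\<eta> / 2 < eigen_defect n \<mu> (Hs i) (Ts i)"
    and x: "almost_eigenvectors n \<mu> (Hs i) (Ts i) (\<eta> / 2 / (c + 1)) x"
    using frequently_ex[OF frequently_eventually_frequently] by blast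
  have "eigen_defect n \<mu> (Hs i) (Ts i) \<le> c * (\<eta> / 2 / (c + 1))"
    unfolding c_def by (rule defect_le_if_almost_eigenvectors[OF csubspaces(1)]) (use x c_def in simp)
  also have "\<dots> < \<eta> / 2" using \<eta> c by (simp add: field_simps)
  finally show False using less by simp
qed

lemma eventually_no_almost_eigenvectors:
  assumes "cmod \<mu> \<le> 1" and "\<eta> > 0" "\<nexists>x. almost_eigenvectors n \<mu> H T \<eta> x"
  shows "\<exists>\<eta>>0. eventually (\<lambda>i. \<nexists>x. almost_eigenvectors n \<mu> (Hs i) (Ts i) \<eta> x) \<U>"
  using limit_almost_eigenvectors[OF assms(1) _ assms(2)] assms(3)
  unfolding frequently_def by blast

section \<open>Convergence of the spectra\<close>

lemma eventually_spectrum_meets_ball: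
  assumes \<mu>: "cmod \<mu> \<le> 1" "\<mu> \<in> spectrum_on H T" and r: "r > 0"
  shows "eventually (\<lambda>i. ball \<mu> r \<inter> spectrum_on (Hs i) (Ts i) \<noteq> {}) \<U>"
proof -
  obtain S where "normal_operator H T S" using models_normal_operator[OF model] .
  then have "\<exists>x. almost_eigenvectors 1 \<mu> H T \<eta> x" if "\<eta> > 0" for \<eta>
    using \<mu>(2) that by (rule normal_operator.spectrum_almost_eigenvector)
  \<comment> \<open>The bound \<open>1 / 2\<close> keeps the vector away from zero;
    \<open>r / 4\<close> makes twice the tolerance smaller than \<open>r\<close>.\<close>
  then have "eventually (\<lambda>i. \<exists>x. almost_eigenvectors 1 \<mu> (Hs i) (Ts i) (min (1 / 2) (r / 4)) x) \<U>"
    using r by (intro eventually_almost_eigenvectors \<mu>(1)) auto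
  then show ?thesis
  proof (rule eventually_mono)
    fix i assume "\<exists>x. almost_eigenvectors 1 \<mu> (Hs i) (Ts i) (min (1 / 2) (r / 4)) x"
    then obtain x where x: "almost_eigenvectors 1 \<mu> (Hs i) (Ts i) (min (1 / 2) (r / 4)) x" ..
    obtain S where "normal_operator (Hs i) (Ts i) S" using models_normal_operator[OF models] .
    from normal_operator.almost_eigenvector_imp_spectrum_near[OF this x]
    show "ball \<mu> r \<inter> spectrum_on (Hs i) (Ts i) \<noteq> {}" using r by simp
  qed
qed

lemma eventually_spectrum_misses_ball:
  assumes \<mu>: "cmod \<mu> \<le> 1" "\<mu> \<notin> spectrum_on H T"
  shows "\<exists>r>0. eventually (\<lambda>i. ball \<mu> r \<inter> spectrum_on (Hs i) (Ts i) = {}) \<U>"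
proof -
  obtain S where "normal_operator H T S" using models_normal_operator[OF model] .
  then obtain \<eta> where "\<eta> > 0" "\<nexists>x. almost_eigenvectors 1 \<mu> H T \<eta> x"
    using normal_operator.notin_spectrum_no_almost_eigenvector \<mu>(2) by blast
  then obtain r where r: "r > 0"
    "eventually (\<lambda>i. \<nexists>x. almost_eigenvectors 1 \<mu> (Hs i) (Ts i) r x) \<U>"
    using eventually_no_almost_eigenvectors[OF \<mu>(1)] by blast
  from r(2) have "eventually (\<lambda>i. ball \<mu> r \<inter> spectrum_on (Hs i) (Ts i) = {}) \<U>"
  proof (rule eventually_mono)
    fix i assume *: "\<nexists>x. almost_eigenvectors 1 \<mu> (Hs i) (Ts i) r x"
    obtain S where "normal_operator (Hs i) (Ts i) S" using models_normal_operator[OF models] .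
    then show "ball \<mu> r \<inter> spectrum_on (Hs i) (Ts i) = {}"
      using * by (rule normal_operator.no_almost_eigenvector_imp_spectrum_disjoint)
  qed
  then show ?thesis using r(1) by blast
qed

text \<open>Finitely many discs centred in the compact limit spectrum cover it, so finitely many
  eventual statements are combined.\<close>

lemma eventually_spectrum_approximated:
  assumes K: "compact (spectrum_on H T)" "spectrum_on H T \<subseteq> cball 0 1" and \<epsilon>: "\<epsilon> > 0"
  shows "eventually (\<lambda>i. \<forall>b\<in>spectrum_on H T. infdist b (spectrum_on (Hs i) (Ts i)) \<le> \<epsilon>) \<U>"
proof -
  let ?K = "spectrum_on H T"
  have "?K \<subseteq> (\<Union>w\<in>?K. ball w (\<epsilon> / 2))" using \<epsilon> by auto
  then obtain F where F: "F \<subseteq> ?K" "finite F" "?K \<subseteq> (\<Union>w\<in>F. ball w (\<epsilon> / 2))"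
    using compactE_image[OF K(1), of ?K "\<lambda>w. ball w (\<epsilon> / 2)"] by auto
  have "eventually (\<lambda>i. \<forall>w\<in>F. ball w (\<epsilon> / 2) \<inter> spectrum_on (Hs i) (Ts i) \<noteq> {}) \<U>"
  proof (rule eventually_ball_finite[OF F(2)], rule ballI)
    fix w assume "w \<in> F"
    then have "w \<in> ?K" "cmod w \<le> 1" using F(1) K(2) by auto
    then show "eventually (\<lambda>i. ball w (\<epsilon> / 2) \<inter> spectrum_on (Hs i) (Ts i) \<noteq> {}) \<U>"
      using \<epsilon> by (intro eventually_spectrum_meets_ball) auto
  qed
  then show ?thesis
  proof (rule eventually_mono, intro ballI)
    fix i b assume *: "\<forall>w\<in>F. ball w (\<epsilon> / 2) \<inter> spectrum_on (Hs i) (Ts i) \<noteq> {}" and "b \<in> ?K"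
    then obtain w where w: "w \<in> F" "dist w b < \<epsilon> / 2" using F(3) by auto
    then obtain z where z: "z \<in> spectrum_on (Hs i) (Ts i)" "dist w z < \<epsilon> / 2" using * by fastforce
    have "infdist b (spectrum_on (Hs i) (Ts i)) \<le> dist b z" using z(1) by (rule infdist_le)
    also have "\<dots> \<le> \<epsilon>" using dist_triangle3[of b z w] w z by simp
    finally show "infdist b (spectrum_on (Hs i) (Ts i)) \<le> \<epsilon>" .
  qed
qed

text \<open>Here compactness is applied to the part of the unit disc at distance at least
  \<open>\<epsilon>\<close> from the limit spectrum: it is covered by finitely many discs, each
  eventually free of spectrum.\<close>

lemma eventually_spectrum_close:
  assumes Ks: "\<And>i. spectrum_on (Hs i) (Ts i) \<subseteq> cball 0 1" and \<epsilon>: "\<epsilon> > 0"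
  shows "eventually (\<lambda>i. \<forall>a\<in>spectrum_on (Hs i) (Ts i). infdist a (spectrum_on H T) \<le> \<epsilon>) \<U>"
proof -
  let ?K = "spectrum_on H T"
  define D where "D = cball 0 1 \<inter> {z. \<epsilon> \<le> infdist z ?K}"
  have "closed {z. \<epsilon> \<le> infdist z ?K}"
    by (intro closed_Collect_le continuous_on_infdist continuous_on_const continuous_on_id)
  then have D: "compact D" unfolding D_def by (intro compact_Int_closed compact_cball)
  have "\<forall>w\<in>D. \<exists>r. r > 0 \<and> eventually (\<lambda>i. ball w r \<inter> spectrum_on (Hs i) (Ts i) = {}) \<U>"
  proof
    fix w assume "w \<in> D"
    then have "cmod w \<le> 1" "w \<notin> ?K" using \<epsilon> by (auto simp: D_def)
    then show "\<exists>r. r > 0 \<and> eventually (\<lambda>i. ball w r \<inter> spectrum_on (Hs i) (Ts i) = {}) \<U>"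
      using eventually_spectrum_misses_ball by blast
  qed
  from bchoice[OF this] obtain r where r: "\<And>w. w \<in> D \<Longrightarrow> r w > 0"
    "\<And>w. w \<in> D \<Longrightarrow> eventually (\<lambda>i. ball w (r w) \<inter> spectrum_on (Hs i) (Ts i) = {}) \<U>" by blast
  have "D \<subseteq> (\<Union>w\<in>D. ball w (r w))" using r(1) by auto
  then obtain F where F: "F \<subseteq> D" "finite F" "D \<subseteq> (\<Union>w\<in>F. ball w (r w))"
    using compactE_image[OF D, of D "\<lambda>w. ball w (r w)"] by auto
  have "eventually (\<lambda>i. \<forall>w\<in>F. ball w (r w) \<inter> spectrum_on (Hs i) (Ts i) = {}) \<U>"
    using F r(2) by (intro eventually_ball_finite) auto
  then show ?thesis
  proof (rule eventually_mono, intro ballI)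
    fix i a assume *: "\<forall>w\<in>F. ball w (r w) \<inter> spectrum_on (Hs i) (Ts i) = {}"
      and a: "a \<in> spectrum_on (Hs i) (Ts i)"
    then have "a \<notin> (\<Union>w\<in>F. ball w (r w))" by blast
    then have "a \<notin> D" using F(3) by blast
    then show "infdist a ?K \<le> \<epsilon>" using subsetD[OF Ks a] by (simp add: D_def)
  qed
qed

text \<open>The Hausdorff distance is meaningful for nonempty sets only. Infinite dimension supplies
  the nonzero vector that \<open>spectrum_nonempty\<close> asks for.\<close>

lemma spectra_nonempty: "spectrum_on (Hs i) (Ts i) \<noteq> {}" "spectrum_on H T \<noteq> {}"
proof -
  have ne: "spectrum_on G U \<noteq> {}" if GU: "models_normal G U" for G :: "'c::complex_hilbert_space set" and U
  proof -
    obtain S where "normal_operator G U S" using models_normal_operator[OF GU] .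
    moreover obtain x where "x \<in> G" "x \<noteq> 0"
      using GU infinite_cdim_nonzero[of G] unfolding models_normal_def by blast
    ultimately show ?thesis by (rule normal_operator.spectrum_nonempty)
  qed
  show "spectrum_on (Hs i) (Ts i) \<noteq> {}" "spectrum_on H T \<noteq> {}"
    using ne models model by blast+
qed

end

lemma hausdorff_distance_bounds:
  assumes "A \<noteq> {}" "B \<noteq> {}" and A: "\<And>a. a \<in> A \<Longrightarrow> infdist a B \<le> \<epsilon>"
    and B: "\<And>b. b \<in> B \<Longrightarrow> infdist b A \<le> \<epsilon>"
  shows "0 \<le> hausdorff_distance A B" "hausdorff_distance A B \<le> \<epsilon>"
proof -
  obtain a where a: "a \<in> A" using assms(1) by blast
  have "0 \<le> infdist a B" by (rule infdist_nonneg)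
  also have "\<dots> \<le> (SUP a\<in>A. infdist a B)" using a A by (intro cSUP_upper bdd_aboveI2) auto
  finally show "0 \<le> hausdorff_distance A B" by (simp add: hausdorff_distance_def le_max_iff_disj)
  show "hausdorff_distance A B \<le> \<epsilon>"
    unfolding hausdorff_distance_def using assms by (intro max.boundedI cSUP_least) auto
qed

context logic_limit
begin

lemma tendsto_hausdorff_distance:
  assumes K: "compact (spectrum_on H T)" "spectrum_on H T \<subseteq> cball 0 1"
    and Ks: "\<And>i. spectrum_on (Hs i) (Ts i) \<subseteq> cball 0 1"
  shows "((\<lambda>i. hausdorff_distance (spectrum_on (Hs i) (Ts i)) (spectrum_on H T)) \<longlongrightarrow> 0) \<U>"
proof (rule tendstoI)
  fix e :: real assume "e > 0"
  then have e: "e / 2 > 0" by simp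
  show "eventually (\<lambda>i. dist (hausdorff_distance (spectrum_on (Hs i) (Ts i)) (spectrum_on H T)) 0 < e) \<U>"
    using eventually_spectrum_close[OF Ks e] eventually_spectrum_approximated[OF K e]
  proof eventually_elim
    case (elim i)
    then show ?case
      using hausdorff_distance_bounds[OF spectra_nonempty, of i "e / 2"] \<open>e > 0\<close> by simp
  qed
qed

text \<open>Forward, exact eigenvectors of the limit are almost eigenvectors for every tolerance,
  which can thus be adapted to each disc. Backward, shrinking discs yield arbitrarily small
  tolerances, and the spectral gap \<open>r\<close> of the limit turns almost eigenvectors into
  eigenvectors.\<close>

lemma multiplicity_iff:
  assumes Es: "\<And>i. is_spectral_measure_on (Hs i) (Ts i) (Es i)"
    and Ks: "\<And>i. compact (spectrum_on (Hs i) (Ts i))"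
    and \<mu>: "\<mu> isolated_in spectrum_on H T" "cmod \<mu> \<le> 1"
  shows "enat n \<le> cdim (eigenspace_on H T \<mu>) \<longleftrightarrow>
    (\<forall>k\<ge>1. eventually (\<lambda>i. enat n \<le> cdim (Es i (ball \<mu> (1 / real k)) ` Hs i)) \<U>)"
    (is "?L \<longleftrightarrow> ?R")
proof -
  have spectral: "\<exists>S. spectral_measure (Hs i) (Ts i) S (Es i)" for i
    using models_normal_operator[OF models, of i] Es Ks
    unfolding spectral_measure_def spectral_measure_axioms_def by blast
  obtain S where "normal_operator H T S" using models_normal_operator[OF model] .
  then interpret normal_operator H T S .
  obtain V where V: "open V" "V \<inter> spectrum_on H T = {\<mu>}" using \<mu>(1) by (auto simp: isolated_in_def)
  then obtain r where r: "r > 0" "ball \<mu> r \<subseteq> V" using openE[of V \<mu>] by blast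
  then have gap: "spectrum_on H T \<inter> ball \<mu> r \<subseteq> {\<mu>}" using V(2) by blast
  show ?thesis
  proof
    assume ?L
    then obtain x where x: "\<forall>j<n. x j \<in> eigenspace_on H T \<mu>" "\<forall>i<n. \<forall>j<n. cinner (x i) (x j) = of_bool (i = j)"
      using ex_orthonormal_family[OF csubspace_eigenspace] by blast
    have "norm (x j) = 1" if "j < n" for j
      using x(2) that by (simp add: norm_eq_one_if_cinner_self)
    then have almost: "almost_eigenvectors n \<mu> H T \<eta> x" if "\<eta> > 0" for \<eta>
      using x that unfolding almost_eigenvectors_def eigenspace_on_def by simp
    show ?R
    proof (intro allI impI)
      fix k :: nat assume k: "k \<ge> 1"
      then have k0: "1 / real k > 0" by simp
      obtain \<eta> where \<eta>: "\<eta> > 0" "real n * (\<eta> + (2 / (1 / real k) * \<eta>)\<^sup>2) < 1" using ex_small_real by blast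
      have "eventually (\<lambda>i. \<exists>x. almost_eigenvectors n \<mu> (Hs i) (Ts i) \<eta> x) \<U>"
        using almost by (intro eventually_almost_eigenvectors[OF \<mu>(2) _ \<eta>(1)]) blast
      then show "eventually (\<lambda>i. enat n \<le> cdim (Es i (ball \<mu> (1 / real k)) ` Hs i)) \<U>"
      proof (rule eventually_mono)
        fix i assume "\<exists>x. almost_eigenvectors n \<mu> (Hs i) (Ts i) \<eta> x"
        then obtain x where x: "almost_eigenvectors n \<mu> (Hs i) (Ts i) \<eta> x" ..
        obtain S where "spectral_measure (Hs i) (Ts i) S (Es i)" using spectral by blast
        then show "enat n \<le> cdim (Es i (ball \<mu> (1 / real k)) ` Hs i)"
          using k0 x \<eta>(2) by (rule spectral_measure.cdim_E_ball_ge)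
      qed
    qed
  next
    assume R: ?R
    have freq: "frequently (\<lambda>i. \<exists>x. almost_eigenvectors n \<mu> (Hs i) (Ts i) \<eta> x) \<U>" if \<eta>: "\<eta> > 0" for \<eta>
    proof -
      \<comment> \<open>Orthonormal vectors in the range of the projection of the disc of radius
        \<open>1 / k\<close> are almost eigenvectors with tolerance \<open>2 / k\<close>.\<close>
      obtain k where k: "k \<noteq> 0" "inverse (real k) < \<eta> / 2" using real_arch_inverse[of "\<eta> / 2"] \<eta> by auto
      then have k': "k \<ge> 1" "1 / real k > 0" "2 * (1 / real k) \<le> \<eta>" by (simp_all add: inverse_eq_divide)
      have "eventually (\<lambda>i. enat n \<le> cdim (Es i (ball \<mu> (1 / real k)) ` Hs i)) \<U>" using R k'(1) by blast
      then have "eventually (\<lambda>i. \<exists>x. almost_eigenvectors n \<mu> (Hs i) (Ts i) \<eta> x) \<U>"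
      proof (rule eventually_mono)
        fix i assume n: "enat n \<le> cdim (Es i (ball \<mu> (1 / real k)) ` Hs i)"
        obtain S where "spectral_measure (Hs i) (Ts i) S (Es i)" using spectral by blast
        from spectral_measure.ex_almost_eigenvectors[OF this k'(2) n]
        show "\<exists>x. almost_eigenvectors n \<mu> (Hs i) (Ts i) \<eta> x"
          using almost_eigenvectors_mono[OF _ k'(3)] by blast
      qed
      then show ?thesis by (rule eventually_frequently[OF \<U>])
    qed
    obtain \<eta> where \<eta>: "\<eta> > 0" "real n * (\<eta> + (2 / r * \<eta>)\<^sup>2) < 1" using ex_small_real by blast
    obtain x where "almost_eigenvectors n \<mu> H T \<eta> x"
      using limit_almost_eigenvectors[OF \<mu>(2) freq \<eta>(1)] by blast
    then show ?L using \<eta>(2) by (rule cdim_eigenspace_ge[OF r(1) gap])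
  qed
qed

end

theorem theorem3p13:
  fixes \<U> :: "'i filter"
    and Ks :: "'i \<Rightarrow> complex set" and ms :: "'i \<Rightarrow> complex \<Rightarrow> enat"
    and Hs :: "'i \<Rightarrow> 'a::complex_hilbert_space set" and Ts :: "'i \<Rightarrow> 'a \<Rightarrow> 'a"
    and K :: "complex set" and m :: "complex \<Rightarrow> enat"
    and H :: "'b::complex_hilbert_space set" and T :: "'b \<Rightarrow> 'b"
  assumes "ultrafilter \<U>"
    and "\<And>i. compact (Ks i)" and "\<And>i. Ks i \<subseteq> cball 0 1"
    and "compact K" and "K \<subseteq> cball 0 1"
    and "\<And>i. models_completion (Ks i) (ms i) (Hs i) (Ts i)"
    and "models_completion K m H T"
    and "limitin logic_topology (\<lambda>i. complete_theory (Hs i) (Ts i)) (complete_theory H T) \<U>"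
  shows "((\<lambda>i. hausdorff_distance (Ks i) K) \<longlongrightarrow> 0) \<U> \<and>
    (\<forall>Es. (\<forall>i. is_spectral_measure_on (Hs i) (Ts i) (Es i)) \<longrightarrow>
       (\<forall>\<mu>. \<mu> isolated_in K \<longrightarrow>
          m \<mu> = (INF k\<in>{1::nat..}.
                   Lim \<U> (\<lambda>i. cdim (Es i (ball \<mu> (1 / real k)) ` Hs i)))))"
proof -
  have K: "spectrum_on H T = K" and Ks: "\<And>i. spectrum_on (Hs i) (Ts i) = Ks i"
    and m: "\<And>\<mu>. \<mu> isolated_in K \<Longrightarrow> cdim (eigenspace_on H T \<mu>) = m \<mu>"
    using assms(6,7) by (auto simp: models_completion_def)
  interpret logic_limit \<U> Hs Ts H T
    using assms by unfold_locales (auto simp: ultrafilter_def models_completion_def)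
  show ?thesis
  proof (intro conjI allI impI)
    show "((\<lambda>i. hausdorff_distance (Ks i) K) \<longlongrightarrow> 0) \<U>"
      using tendsto_hausdorff_distance assms(3-5) unfolding K Ks by blast
  next
    fix Es \<mu>
    assume Es: "\<forall>i. is_spectral_measure_on (Hs i) (Ts i) (Es i)" and \<mu>: "\<mu> isolated_in K"
    let ?f = "\<lambda>k i. cdim (Es i (ball \<mu> (1 / real k)) ` Hs i)"
    have "\<mu> \<in> K" using \<mu> by (auto simp: isolated_in_def)
    then have "cmod \<mu> \<le> 1" using assms(5) by auto
    then have iff: "enat n \<le> m \<mu> \<longleftrightarrow> (\<forall>k\<ge>1. eventually (\<lambda>i. enat n \<le> ?f k i) \<U>)" for n
      using multiplicity_iff[of Es \<mu> n] Es assms(2) \<mu> m[OF \<mu>] unfolding K Ks by simp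
    \<comment> \<open>Lower bounds by \<open>enat n\<close> commute with the infimum over
      \<open>k\<close> and, by \<open>enat_le_Lim_iff\<close>, with the limit along the
      ultrafilter.\<close>
    show "m \<mu> = (INF k\<in>{1::nat..}. Lim \<U> (?f k))"
    proof (rule enat_eqI_le)
      fix n
      show "enat n \<le> m \<mu> \<longleftrightarrow> enat n \<le> (INF k\<in>{1::nat..}. Lim \<U> (?f k))"
        unfolding iff le_INF_iff enat_le_Lim_iff[OF assms(1)] by auto
    qed
  qed
qed

end
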